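(* Consider the SEA model (see context) on $\mathcal{X}\subseteq\mathbb{R}^d$ with horizon $T$. Assume there are constants $G,D,L,\lambda>0$ and $\sigma_{\max}^2,\Sigma_{\max}^2\ge0$ with $2\sigma_{\max}^2+\Sigma_{\max}^2>0$ such that: (i) $\max_{\mathbf{x}\in\mathcal{X}}\|\nabla f_t(\mathbf{x})\|_2\le G$ for every individual function $f_t$, $t\in[T]$; (ii) $\mathbf{0}\in\mathcal{X}$ and $\|\mathbf{x}-\mathbf{y}\|_2\le D$ for all $\mathbf{x},\mathbf{y}\in\mathcal{X}$; (iii) $\sigma_t^2\le\sigma_{\max}^2$ and $\sup_{\mathbf{x}\in\mathcal{X}}\|\nabla F_t(\mathbf{x})-\nabla F_{t-1}(\mathbf{x})\|_2^2\le\Sigma_{\max}^2$ for all $t\in[T]$; (iv) every expected function $F_t$ is $L$-smooth on $\mathcal{X}$, i.e. $\|\nabla F_t(\mathbf{x})-\nabla F_t(\mathbf{y})\|_2\le L\|\mathbf{x}-\mathbf{y}\|_2$ for all $\mathbf x,\mathbf y\in\mathcal X$; (v) every expected function $F_t$ is $\lambda$-strongly convex on $\mathcal{X}$ with respect to $\|\cdot\|_2$. Let $\Pi_{\mathcal{X}}$ be the Euclidean projection onto $\mathcal{X}$, let $\mathbf{x}_1=\hat{\mathbf{x}}_1$ be any point of $\mathcal{X}$, and run $$\hat{\mathbf{x}}_{t+1}=\Pi_{\mathcal{X}}\big[\hat{\mathbf{x}}_t-\eta_t\nabla f_t(\mathbf{x}_t)\big],\qquad \mathbf{x}_{t+1}=\Pi_{\mathcal{X}}\big[\hat{\mathbf{x}}_{t+1}-\eta_{t+1}\nabla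 f_t(\mathbf{x}_t)\big],\qquad \eta_t=\frac{2}{\lambda t}.$$ Then for every fixed $\mathbf{u}\in\mathcal{X}$, $$\mathbb{E}\Big[\sum_{t=1}^T f_t(\mathbf{x}_t)-\sum_{t=1}^T f_t(\mathbf{u})\Big]\le\frac{32\sigma_{\max}^2+16\Sigma_{\max}^2}{\lambda}\ln\Big(\frac{2\sigma_{1:T}^2+\Sigma_{1:T}^2}{2\sigma_{\max}^2+\Sigma_{\max}^2}+1\Big)+\frac{64\sigma_{\max}^2+32\Sigma_{\max}^2}{\lambda}+\frac{16L^2D^2}{\lambda}\ln\Big(1+8\sqrt2\,\frac L\lambda\Big)+\frac{16L^2D^2+4G^2}{\lambda}+\frac{\lambda D^2}{4}.$$ In particular the expected regret is $\mathcal{O}\Big(\frac1\lambda(\sigma_{\max}^2+\Sigma_{\max}^2)\log\frac{\sigma_{1:T}^2+\Sigma_{1:T}^2}{\sigma_{\max}^2+\Sigma_{\max}^2}\Big)$.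
   Context: SEA (Stochastically Extended Adversarial) model: $d,T\ge1$, $[T]=\{1,\dots,T\}$, and $\mathcal{X}\subseteq\mathbb{R}^d$ is a nonempty closed convex feasible domain. In each round $t\in[T]$ the learner selects $\mathbf{x}_t\in\mathcal{X}$ based on the previously observed functions $f_1,\dots,f_{t-1}$; nature chooses a distribution $\mathfrak{D}_t$ over differentiable functions $\mathcal{X}\to\mathbb{R}$ (possibly random, depending on the past); then the individual (random) function $f_t$ is sampled from $\mathfrak{D}_t$ (i.e. conditionally on the past and on $\mathfrak{D}_t$, $f_t$ has law $\mathfrak{D}_t$), the learner suffers $f_t(\mathbf{x}_t)$ and observes $f_t$. The (conditional) expected function is $F_t(\mathbf{x})=\mathbb{E}_{f_t\sim\mathfrak{D}_t}[f_t(\mathbf{x})]$, and differentiation and expectation may be interchanged: $\nabla F_t(\mathbf{x})=\mathbb{E}_{f_t\sim\mathfrak{D}_t}[\nabla f_t(\mathbf{x})]$. Define $$\sigma_t^2=\sup_{\mathbf{x}\in\mathcal{X}}\mathbb{E}_{f_t\sim\mathfrak{D}_t}\big[\|\nabla f_t(\mathbf{x})-\nabla F_t(\mathbf{x})\|_2^2\big],\quad \sigma_{1:T}^2=\mathbb{E}\Big[\sum_{t=1}^T\sigma_t^2\Big],\quad \Sigma_{1:T}^2=\mathbb{E}\Big[\sum_{t=1}^T\sup_{\mathbf{x}\in\mathcal{X}}\|\nabla F_t(\mathbf{x})-\nabla F_{t-1}(\mathbf{x})\|_2^2\Big],$$ with $\nabla F_0\equiv\mathbf 0$. The $\mathcal{O}$-notation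 means: bounded by $\frac{C}{\lambda}(\sigma_{\max}^2+\Sigma_{\max}^2)\log\big(1+\frac{\sigma_{1:T}^2+\Sigma_{1:T}^2}{\sigma_{\max}^2+\Sigma_{\max}^2}\big)+C'$ with $C$ a universal constant and $C'$ depending only on $D,G,L,\lambda,\sigma_{\max}^2,\Sigma_{\max}^2$ (not on $T$). *)

theory Defs
  imports "HOL-Probability.Probability"
begin

text \<open>
  Only used at points where \<open>f\<close> is differentiable; there the \<open>THE\<close> is well defined.  Differentiability
  at a point of the feasible domain is meant in a full neighbourhood of that point, so that the
  gradient is unique even if the domain has empty interior.
\<close>

definition gradient :: "('a::real_inner \<Rightarrow> real) \<Rightarrow> 'a \<Rightarrow> 'a" where
  "gradient f x = (THE g. GDERIV f x :> g)"

definition strongly_convex_on :: "'a::real_normed_vector set \<Rightarrow> real \<Rightarrow> ('a \<Rightarrow> real) \<Rightarrow> bool" where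
  "strongly_convex_on X \<mu> F \<longleftrightarrow>
     (\<forall>x\<in>X. \<forall>y\<in>X. \<forall>s\<in>{0..1}.
        F (s *\<^sub>R x + (1 - s) *\<^sub>R y)
          \<le> s * F x + (1 - s) * F y - \<mu> / 2 * s * (1 - s) * (norm (x - y))\<^sup>2)"

text \<open>
  The measurable space of loss functions: functions differentiable at every point of \<open>X\<close>, with the
  \<open>\<sigma>\<close>-algebra generated by the point evaluations.  It makes \<open>(f, x) \<mapsto> f x\<close> and
  \<open>(f, x) \<mapsto> gradient f x\<close> jointly measurable on \<open>loss_space X \<times> X\<close>.
\<close>

definition loss_space :: "'a::euclidean_space set \<Rightarrow> ('a \<Rightarrow> real) measure" where
  "loss_space X = restrict_space (PiM UNIV (\<lambda>_. borel)) {f. \<forall>x\<in>X. \<exists>g. GDERIV f x :> g}"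

definition expected_loss :: "('a \<Rightarrow> real) measure \<Rightarrow> 'a \<Rightarrow> real" where
  "expected_loss Q x = (LINT f|Q. f x)"

text \<open>
  Suprema of second moments are taken in \<^typ>\<open>ennreal\<close>, where they always exist.  Such a supremum over
  \<open>X\<close> need not be a measurable function of the outcome; its non-negative integral is then the lower
  integral, so no measurability assumption is needed, and the ordinary expectation is recovered in
  the measurable case.
\<close>

definition loss_variance :: "'a::euclidean_space set \<Rightarrow> ('a \<Rightarrow> real) measure \<Rightarrow> ennreal" where
  "loss_variance X Q =
     (SUP x\<in>X. \<integral>\<^sup>+ f. ennreal ((norm (gradient f x - gradient (expected_loss Q) x))\<^sup>2) \<partial>Q)"

definition expected_gradient ::
    "(nat \<Rightarrow> 'w \<Rightarrow> ('a::euclidean_space \<Rightarrow> real) measure) \<Rightarrow> nat \<Rightarrow> 'w \<Rightarrow> 'a \<Rightarrow> 'a" where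
  "expected_gradient Q t w x = (if t = 0 then 0 else gradient (expected_loss (Q t w)) x)"

definition gradient_drift ::
    "'a::euclidean_space set \<Rightarrow> (nat \<Rightarrow> 'w \<Rightarrow> ('a \<Rightarrow> real) measure) \<Rightarrow> nat \<Rightarrow> 'w \<Rightarrow> ennreal" where
  "gradient_drift X Q t w =
     (SUP x\<in>X. ennreal ((norm (expected_gradient Q t w x - expected_gradient Q (t - 1) w x))\<^sup>2))"

text \<open>
  The quantities \<open>\<sigma>\<^sup>2\<close> and \<open>\<Sigma>\<^sup>2\<close> over rounds 1 to \<open>T\<close>.  The conversion to \<^typ>\<open>real\<close> is harmless when
  the summands are almost surely bounded, since the integrals are then finite.
\<close>

definition cumulative_variance ::
    "'w measure \<Rightarrow> 'a::euclidean_space set \<Rightarrow> nat \<Rightarrow> (nat \<Rightarrow> 'w \<Rightarrow> ('a \<Rightarrow> real) measure) \<Rightarrow> real" where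
  "cumulative_variance M X T Q = enn2real (\<integral>\<^sup>+ w. (\<Sum>t=1..T. loss_variance X (Q t w)) \<partial>M)"

definition cumulative_drift ::
    "'w measure \<Rightarrow> 'a::euclidean_space set \<Rightarrow> nat \<Rightarrow> (nat \<Rightarrow> 'w \<Rightarrow> ('a \<Rightarrow> real) measure) \<Rightarrow> real" where
  "cumulative_drift M X T Q = enn2real (\<integral>\<^sup>+ w. (\<Sum>t=1..T. gradient_drift X Q t w) \<partial>M)"

text \<open>
  Stochastically extended adversarial model.  \<open>\<F> (t - 1)\<close> is everything determined before \<open>f t\<close> is
  sampled: the earlier losses, and nature's choice \<open>Q t\<close> together with any randomness behind it.
  The smallest possible choice is the \<open>\<sigma>\<close>-algebra generated by \<open>f 1, \<dots>, f (t - 1), Q 1, \<dots>, Q t\<close>.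
\<close>

locale sea_model = prob_space M + filtration "space M" \<F>
  for M :: "'w measure" and \<F> :: "nat \<Rightarrow> 'w measure" +
  fixes X :: "'a::euclidean_space set"
    and T :: nat
    and f :: "nat \<Rightarrow> 'w \<Rightarrow> 'a \<Rightarrow> real"
    and Q :: "nat \<Rightarrow> 'w \<Rightarrow> ('a \<Rightarrow> real) measure"
  assumes X_nonempty: "X \<noteq> {}"
    and X_closed: "closed X"
    and X_convex: "convex X"
    and T_pos: "T \<ge> 1"
    and subalg: "\<And>t. subalgebra M (\<F> t)"
    and Q_measurable: "\<And>t. t \<in> {1..T} \<Longrightarrow> Q t \<in> measurable (\<F> (t - 1)) (prob_algebra (loss_space X))"
    and f_measurable: "\<And>t. t \<in> {1..T} \<Longrightarrow> f t \<in> measurable (\<F> t) (loss_space X)"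
    and f_conditional_law: "\<And>t A. t \<in> {1..T} \<Longrightarrow> A \<in> sets (loss_space X) \<Longrightarrow>
      AE w in M. real_cond_exp M (\<F> (t - 1)) (\<lambda>w. indicator A (f t w)) w = measure (Q t w) A"
    and interchange: "AE w in M. \<forall>t\<in>{1..T}. \<forall>x\<in>X.
      integrable (Q t w) (\<lambda>f. f x) \<and>
      integrable (Q t w) (\<lambda>f. gradient f x) \<and>
      (GDERIV (expected_loss (Q t w)) x :> (LINT f|Q t w. gradient f x))"

text \<open>
  The \<open>T\<close>-independent additive part of the regret bound, a function of the problem constants only
  (\<open>s\<close> and \<open>S\<close> bound the per-round variance and drift).  It is given explicitly because an
  existentially quantified constant inside a theorem could depend on its type variables, that is, on
  the dimension and the sample space.
\<close>

definition regret_offset :: "real \<Rightarrow> real \<Rightarrow> real \<Rightarrow> real \<Rightarrow> real \<Rightarrow> real \<Rightarrow> real" where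
  "regret_offset D G L \<mu> s S =
     (64 * s + 32 * S) / \<mu>
     + 16 * L\<^sup>2 * D\<^sup>2 / \<mu> * ln (1 + 8 * sqrt 2 * (L / \<mu>))
     + (16 * L\<^sup>2 * D\<^sup>2 + 4 * G\<^sup>2) / \<mu>
     + \<mu> * D\<^sup>2 / 4"

end

theory Submission
  imports Defs
begin

text \<open>
  Conditioning on the past replaces \<open>f t (x t) - f t u\<close> by its mean, which strong convexity bounds by
  \<open>inner (gradient (f t) (x t)) (x t - u) - \<mu> / 2 * (norm (x t - u))\<^sup>2\<close> in expectation.
  Summed along a path, the optimistic steps with \<open>\<eta> t = 2 / (\<mu> * t)\<close> leave
  \<open>4 / (\<mu> * t) * (norm (g t - g (t - 1)))\<^sup>2\<close> minus a multiple of the movement \<open>(norm (x t - x (t - 1)))\<^sup>2\<close>.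
  The gradient variation splits into two noise terms, the drift of the mean gradient, and a smoothness
  term which the movement term absorbs as soon as \<open>t - 1 \<ge> 8 * sqrt 2 * L / \<mu>\<close>.  What remains is a sum
  of terms \<open>c t / t\<close> with bounded \<open>c t\<close>, which is logarithmic in \<open>sum c\<close>.
\<close>

section \<open>Pathwise regret of optimistic mirror descent\<close>

text \<open>The step size makes \<open>1 / (2 * \<eta> t)\<close> equal to
  \<open>\<mu> * t / 4\<close>. Strong convexity, transferred from the played point to the next
  auxiliary point at the cost of a factor 2, raises the coefficient of the squared distance to
  \<open>u\<close> from \<open>t\<close> to \<open>t + 1\<close>, which is exactly what the next
  round starts with, so the potential telescopes. The weights proportional to \<open>1 / t\<close>
  are deterministic. Expectations are therefore taken before the logarithmic estimate, which is
  applied to plain numbers, and no concavity argument for the logarithm of a random sum arises. Two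
  probabilistic obstacles shape the rest. The conditional law is given one event at a time, with an
  exceptional set depending on the event, whereas the integrands involve a random point determined
  by the past; an identity of joint laws bridges the two. The suprema over \<open>X\<close> may fail
  to be measurable, so only conditional second moments at the iterates are integrated, and these are
  compared with the suprema through the lower integral.\<close>

lemma sum_divide_le_ln:
  fixes c :: "nat \<Rightarrow> real"
  assumes "\<And>t. t \<in> {2..n} \<Longrightarrow> 0 \<le> c t \<and> c t \<le> 1"
  shows "(\<Sum>t=2..n. c t / real t) \<le> ln (1 + (\<Sum>t=2..n. c t))"
  using assms
proof (induction n)
  case (Suc n)
  show ?case
  proof (cases "n = 0")
    case False
    define S where "S = (\<Sum>t=2..n. c t)"
    have c: "0 \<le> c (Suc n)" "c (Suc n) \<le> 1"
      using Suc.prems[of "Suc n"] False by auto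
    have S0: "0 \<le> S" unfolding S_def by (rule sum_nonneg) (use Suc.prems in auto)
    have "S \<le> (\<Sum>t=2..n. 1)" unfolding S_def by (rule sum_mono) (use Suc.prems in auto)
    \<comment> \<open>The sum starts at 2 and its terms are at most 1, so the index dominates 1 plus
      the partial sum. Replacing the index by that quantity turns the new term into a lower Riemann
      estimate for the increment of \<open>ln\<close>.\<close>
    then have Sn: "1 + S + c (Suc n) \<le> real (Suc n)" using False c by (simp add: of_nat_diff)
    have "c (Suc n) / real (Suc n) \<le> c (Suc n) / (1 + S + c (Suc n))"
      using Sn S0 c by (intro divide_left_mono) auto
    also have "\<dots> = 1 - (1 + S) / (1 + S + c (Suc n))" using S0 c by (simp add: field_simps)
    also have "\<dots> \<le> - ln ((1 + S) / (1 + S + c (Suc n)))"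
      using ln_le_minus_one[of "(1 + S) / (1 + S + c (Suc n))"] S0 c by simp
    also have "\<dots> = ln (1 + S + c (Suc n)) - ln (1 + S)" using S0 c by (simp add: ln_div)
    finally show ?thesis using Suc False by (simp add: S_def add.assoc)
  qed simp
qed simp

lemma truncated_harmonic_le_ln:
  fixes \<kappa> :: real
  assumes "0 \<le> \<kappa>"
  shows "(\<Sum>t=2..n. if real t - 1 < \<kappa> then 1 / real t else 0) \<le> ln (1 + \<kappa>)"
proof (cases "n = 0")
  case False
  \<comment> \<open>The minimum makes the induction close: the bound grows like \<open>ln n\<close>
    while terms are still counted and stays constant or grows harmlessly afterwards. Index
    \<open>Suc n\<close> is counted exactly when \<open>real n < \<kappa>\<close>, that is, when the
    minimum is still attained by its first argument.\<close>
  have "(\<Sum>t=2..n. if real t - 1 < \<kappa> then 1 / real t else 0) \<le> ln (min (real n) (1 + \<kappa>))"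
    using False[unfolded neq0_conv]
  proof (induction n rule: nat_induct_non_zero)
    case 1 then show ?case using assms by simp
  next
    case (Suc n)
    show ?case
    proof (cases "real n < \<kappa>")
      case True
      have "1 / real (Suc n) = 1 - real n / real (Suc n)" by (simp add: field_simps)
      also have "\<dots> \<le> - ln (real n / real (Suc n))"
        using ln_le_minus_one[of "real n / real (Suc n)"] Suc by simp
      also have "\<dots> = ln (real (Suc n)) - ln (real n)" using Suc by (simp add: ln_div)
      finally show ?thesis using Suc True by simp
    next
      case F: False
      have "ln (min (real n) (1 + \<kappa>)) \<le> ln (min (real (Suc n)) (1 + \<kappa>))"
        using Suc assms by (intro ln_mono) auto
      then show ?thesis using Suc F by simp
    qed
  qed
  also have "\<dots> \<le> ln (1 + \<kappa>)" using False assms by (intro ln_mono) auto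
  finally show ?thesis .
qed (use assms in simp)

lemma norm_add2_power2_le:
  fixes a b :: "'a::real_inner"
  shows "(norm (a + b))\<^sup>2 \<le> 2 * (norm a)\<^sup>2 + 2 * (norm b)\<^sup>2"
proof -
  have "2 * (norm a)\<^sup>2 + 2 * (norm b)\<^sup>2 - (norm (a + b))\<^sup>2 = (norm (a - b))\<^sup>2"
    by (simp add: power2_norm_eq_inner algebra_simps inner_commute)
  then show ?thesis by (smt (verit) zero_le_power2)
qed

lemma norm_add4_power2_le:
  fixes a b c d :: "'a::real_inner"
  shows "(norm (a + b + c + d))\<^sup>2 \<le> 4 * ((norm a)\<^sup>2 + (norm b)\<^sup>2 + (norm c)\<^sup>2 + (norm d)\<^sup>2)"
  using norm_add2_power2_le[of "a + b" "c + d"] norm_add2_power2_le[of a b]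
    norm_add2_power2_le[of c d] by (simp add: add.assoc)

text \<open>Nonexpansiveness of the projection gives the stability bound. For the regret bound,
  \<open>x - u\<close> is split at \<open>y\<close>: the part \<open>y - u\<close> is handled by the
  variational inequality of \<open>y\<close> tested at \<open>u\<close>, the part
  \<open>x - y\<close> by that of \<open>x\<close> tested at \<open>y\<close>, and the mismatch
  \<open>inner (g - m) (x - y)\<close> is what the quality of the hint \<open>m\<close> and
  stability control.\<close>

lemma optimistic_mirror_descent_step:
  fixes X :: "'a::euclidean_space set"
  assumes X: "convex X" "closed X" "u \<in> X" and \<eta>: "\<eta> > 0"
    and x: "x = closest_point X (a - \<eta> *\<^sub>R m)" and y: "y = closest_point X (a - \<eta> *\<^sub>R g)"
  shows "norm (x - y) \<le> \<eta> * norm (g - m)" (is ?stable)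
    and "inner g (x - u) \<le> ((norm (a - u))\<^sup>2 - (norm (y - u))\<^sup>2) / (2 * \<eta>) + \<eta> * (norm (g - m))\<^sup>2
           - ((norm (x - a))\<^sup>2 + (norm (x - y))\<^sup>2) / (2 * \<eta>)" (is ?regret)
proof -
  have "X \<noteq> {}" using X by auto
  have "norm (x - y) \<le> norm ((a - \<eta> *\<^sub>R m) - (a - \<eta> *\<^sub>R g))"
    unfolding x y using closest_point_lipschitz[OF X(1,2) \<open>X \<noteq> {}\<close>] unfolding dist_norm .
  also have "(a - \<eta> *\<^sub>R m) - (a - \<eta> *\<^sub>R g) = \<eta> *\<^sub>R (g - m)" by (simp add: algebra_simps)
  finally show st: ?stable using \<eta> by simp
  have yX: "y \<in> X" unfolding y using closest_point_in_set[OF X(2) \<open>X \<noteq> {}\<close>] .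
  have 1: "inner (a - \<eta> *\<^sub>R g - y) (u - y) \<le> 0"
    unfolding y by (rule closest_point_dot[OF X])
  have 2: "inner (a - \<eta> *\<^sub>R m - x) (y - x) \<le> 0"
    unfolding x by (rule closest_point_dot[OF X(1,2) yX])
  have "inner (g - m) (x - y) \<le> norm (g - m) * norm (x - y)" by (rule norm_cauchy_schwarz)
  also have "\<dots> \<le> norm (g - m) * (\<eta> * norm (g - m))" using st by (intro mult_left_mono) auto
  finally have 3: "\<eta> * inner (g - m) (x - y) \<le> \<eta> * (\<eta> * (norm (g - m))\<^sup>2)"
    using \<eta> by (intro mult_left_mono) (auto simp: power2_eq_square algebra_simps)
  \<comment> \<open>An exact identity: the squared norms come from polarizing the two projection
    inequalities, so nothing is lost before signs are used.\<close>
  have "2 * (\<eta> * inner g (x - u)) =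
     2 * (\<eta> * inner (g - m) (x - y)) + 2 * inner (a - \<eta> *\<^sub>R g - y) (u - y)
     + 2 * inner (a - \<eta> *\<^sub>R m - x) (y - x)
     + ((norm (a - u))\<^sup>2 - (norm (y - u))\<^sup>2) - ((norm (x - a))\<^sup>2 + (norm (x - y))\<^sup>2)"
    by (simp add: power2_norm_eq_inner algebra_simps inner_commute)
  then have "2 * (\<eta> * inner g (x - u)) \<le> 2 * (\<eta> * (\<eta> * (norm (g - m))\<^sup>2))
     + ((norm (a - u))\<^sup>2 - (norm (y - u))\<^sup>2) - ((norm (x - a))\<^sup>2 + (norm (x - y))\<^sup>2)"
    using 1 2 3 by linarith
  then have "2 * (\<eta> * inner g (x - u)) / (2 * \<eta>) \<le> (2 * (\<eta> * (\<eta> * (norm (g - m))\<^sup>2))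
     + ((norm (a - u))\<^sup>2 - (norm (y - u))\<^sup>2) - ((norm (x - a))\<^sup>2 + (norm (x - y))\<^sup>2)) / (2 * \<eta>)"
    using \<eta> by (intro divide_right_mono) auto
  then show ?regret using \<eta> by (simp add: add_divide_distrib diff_divide_distrib)
qed

text \<open>The strong convexity term lives at \<open>x\<close> but the potential at
  \<open>y\<close>, hence the passage through the squared triangle inequality. Its price,
  \<open>\<mu> / 2 * (norm (x - y))\<^sup>2\<close>, is by stability at most another
  \<open>\<eta> * (norm (g - m))\<^sup>2\<close>, because
  \<open>\<mu> * \<eta> / 2 = 1 / t \<le> 1\<close>. This is why the gradient error carries
  \<open>4 / (\<mu> * t) = 2 * \<eta>\<close>.\<close>

lemma strongly_convex_step:
  fixes X :: "'a::euclidean_space set"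
  assumes X: "convex X" "closed X" "u \<in> X" and \<mu>: "\<mu> > 0" and t: "t \<ge> 1" and \<eta>: "\<eta> = 2 / (\<mu> * real t)"
    and x: "x = closest_point X (a - \<eta> *\<^sub>R m)" and y: "y = closest_point X (a - \<eta> *\<^sub>R g)"
  shows "inner g (x - u) - \<mu> / 2 * (norm (x - u))\<^sup>2
      \<le> \<mu> / 4 * real t * (norm (a - u))\<^sup>2 - \<mu> / 4 * (real t + 1) * (norm (y - u))\<^sup>2
        + 4 / (\<mu> * real t) * (norm (g - m))\<^sup>2
        - \<mu> / 4 * real t * ((norm (x - a))\<^sup>2 + (norm (x - y))\<^sup>2)"
proof -
  have \<eta>0: "\<eta> > 0" using \<mu> t \<eta> by simp
  note step = optimistic_mirror_descent_step[OF X \<eta>0 x y]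
  have c: "z / (2 * \<eta>) = \<mu> / 4 * real t * z" for z unfolding \<eta> by simp
  have "(norm (y - u))\<^sup>2 \<le> 2 * (norm (x - y))\<^sup>2 + 2 * (norm (x - u))\<^sup>2"
    using norm_add2_power2_le[of "y - x" "x - u"] by (simp add: norm_minus_commute)
  then have "\<mu> / 4 * (norm (y - u))\<^sup>2 \<le> \<mu> / 4 * (2 * (norm (x - y))\<^sup>2 + 2 * (norm (x - u))\<^sup>2)"
    using \<mu> by (intro mult_left_mono) auto
  then have 1: "\<mu> / 4 * (norm (y - u))\<^sup>2 \<le> \<mu> / 2 * (norm (x - y))\<^sup>2 + \<mu> / 2 * (norm (x - u))\<^sup>2"
    by (simp add: field_simps)
  have "\<mu> / 2 * (norm (x - y))\<^sup>2 \<le> \<mu> / 2 * (\<eta> * norm (g - m))\<^sup>2"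
    using step(1) \<mu> by (intro mult_left_mono power_mono) auto
  also have "\<dots> = (\<mu> * \<eta> / 2) * (\<eta> * (norm (g - m))\<^sup>2)"
    by (simp add: power2_eq_square)
  also have "\<dots> \<le> 1 * (\<eta> * (norm (g - m))\<^sup>2)"
    using \<mu> t \<eta>0 unfolding \<eta> by (intro mult_right_mono) auto
  finally have 2: "\<mu> / 2 * (norm (x - y))\<^sup>2 \<le> \<eta> * (norm (g - m))\<^sup>2" by simp
  have 3: "4 / (\<mu> * real t) * (norm (g - m))\<^sup>2 = 2 * (\<eta> * (norm (g - m))\<^sup>2)" unfolding \<eta> by simp
  have 4: "\<mu> / 4 * (real t + 1) * (norm (y - u))\<^sup>2 = \<mu> / 4 * real t * (norm (y - u))\<^sup>2 + \<mu> / 4 * (norm (y - u))\<^sup>2"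
    by (simp add: algebra_simps)
  show ?thesis using step(2) 1 2 unfolding c 3 4 right_diff_distrib by linarith
qed

lemma pathwise_regret_bound:
  fixes X :: "'a::euclidean_space set" and x xh g :: "nat \<Rightarrow> 'a" and p :: "nat \<Rightarrow> 'a \<Rightarrow> 'a"
  assumes X: "convex X" "closed X" "u \<in> X" and diam: "\<And>y z. y \<in> X \<Longrightarrow> z \<in> X \<Longrightarrow> norm (y - z) \<le> D"
    and \<mu>: "\<mu> > 0" and L: "L > 0" and T: "T \<ge> 1"
    and \<eta>: "\<And>t. \<eta> t = 2 / (\<mu> * real t)"
    and init: "x 1 \<in> X" "xh 1 = x 1"
    and update: "\<And>t. t \<in> {1..<T} \<Longrightarrow> xh (t + 1) = closest_point X (xh t - \<eta> t *\<^sub>R g t)"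
      "\<And>t. t \<in> {1..<T} \<Longrightarrow> x (t + 1) = closest_point X (xh (t + 1) - \<eta> (t + 1) *\<^sub>R g t)"
    and G: "norm (g 1) \<le> G"
    and smooth: "\<And>t. t \<in> {1..<T} \<Longrightarrow>
      norm (p (t + 1) (x (t + 1)) - p (t + 1) (x t)) \<le> L * norm (x (t + 1) - x t)"
  shows "(\<Sum>t=1..T. inner (g t) (x t - u) - \<mu> / 2 * (norm (x t - u))\<^sup>2)
    \<le> \<mu> * D\<^sup>2 / 4 + 4 * G\<^sup>2 / \<mu> + 16 * L\<^sup>2 * D\<^sup>2 / \<mu> * ln (1 + 8 * sqrt 2 * (L / \<mu>))
      + (\<Sum>t=2..T. 16 / (\<mu> * real t) * ((norm (g t - p t (x t)))\<^sup>2
          + (norm (p t (x (t - 1)) - p (t - 1) (x (t - 1))))\<^sup>2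
          + (norm (g (t - 1) - p (t - 1) (x (t - 1))))\<^sup>2))"
proof -
  have ne: "X \<noteq> {}" using X by auto
  \<comment> \<open>The auxiliary point after round \<open>t\<close>. It agrees with
    \<open>xh (t + 1)\<close> for \<open>t < T\<close> and also exists for \<open>t = T\<close>,
    where the update rule prescribes nothing.\<close>
  define y where "y t = closest_point X (xh t - \<eta> t *\<^sub>R g t)" for t
  define e where "e t = (norm (g t - p t (x t)))\<^sup>2" for t
  define d where "d t = (norm (p t (x (t - 1)) - p (t - 1) (x (t - 1))))\<^sup>2" for t
  define q where "q t = (norm (x t - x (t - 1)))\<^sup>2" for t
  define R where "R t = inner (g t) (x t - u) - \<mu> / 2 * (norm (x t - u))\<^sup>2" for t
  \<comment> \<open>The constant 16 is the 4 of the single-step bound times the 4 from splitting the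
    gradient variation into four vectors. The subtracted part of the last coefficient is the credit
    earned by movement.\<close>
  define B where "B t = 16 / (\<mu> * real t) * (e t + d t + e (t - 1))
      + (16 * L\<^sup>2 / (\<mu> * real t) - \<mu> * (real t - 1) / 8) * q t" for t
  have xX: "x t \<in> X" if "t \<in> {1..T}" for t
  proof (cases "t = 1")
    case False
    then have "t - 1 \<in> {1..<T}" "t - 1 + 1 = t" using that by auto
    then have "x t = closest_point X (xh t - \<eta> t *\<^sub>R g (t - 1))" using update(2)[of "t - 1"] by metis
    then show ?thesis using closest_point_in_set[OF X(2) ne] by simp
  qed (use init in simp)
  \<comment> \<open>Two negative terms are carried along: the first cancels the opening potential of
    the next round, the second is a reserve that helps to pay for the movement from
    \<open>x n\<close> to \<open>x (Suc n)\<close>.\<close>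
  have "sum R {1..n} \<le> \<mu> * D\<^sup>2 / 4 + 4 * G\<^sup>2 / \<mu> + sum B {2..n}
          - \<mu> / 4 * (real n + 1) * (norm (y n - u))\<^sup>2 - \<mu> / 4 * real n * (norm (x n - y n))\<^sup>2"
    if "1 \<le> n" "n \<le> T" for n
    using that
  proof (induction n rule: nat_induct_at_least)
    case base
    \<comment> \<open>The initial point counts as a step with hint 0, so the whole first gradient
      enters as gradient error and yields \<open>4 * G\<^sup>2 / \<mu>\<close>.\<close>
    have x1: "x 1 = closest_point X (xh 1 - \<eta> 1 *\<^sub>R 0)" using init by (simp add: closest_point_self)
    have "R 1 \<le> \<mu> / 4 * (norm (x 1 - u))\<^sup>2 - \<mu> / 4 * 2 * (norm (y 1 - u))\<^sup>2
        + 4 / \<mu> * (norm (g 1))\<^sup>2 - \<mu> / 4 * ((norm (x 1 - y 1))\<^sup>2)"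
      using strongly_convex_step[OF X \<mu> order_refl \<eta>[of 1, folded One_nat_def] x1 y_def[of 1]] init
      by (simp add: R_def)
    moreover have "(norm (x 1 - u))\<^sup>2 \<le> D\<^sup>2" using diam[OF init(1) X(3)] by (intro power_mono) auto
    then have "\<mu> / 4 * (norm (x 1 - u))\<^sup>2 \<le> \<mu> / 4 * D\<^sup>2" using \<mu> by (intro mult_left_mono) auto
    moreover have "4 / \<mu> * (norm (g 1))\<^sup>2 \<le> 4 / \<mu> * G\<^sup>2" using \<mu> G by (intro mult_left_mono power_mono) auto
    ultimately show ?case by simp
  next
    case (Suc n)
    have n: "n \<in> {1..<T}" using Suc by auto
    define s where "s = real (Suc n)"
    have s: "s \<ge> 1" "real n = s - 1" by (auto simp: s_def)
    have xh: "xh (Suc n) = y n" using update(1)[OF n] by (simp add: y_def)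
    have xS: "x (Suc n) = closest_point X (xh (Suc n) - \<eta> (Suc n) *\<^sub>R g n)" using update(2)[OF n] by simp
    have 1: "R (Suc n) \<le> \<mu> / 4 * s * (norm (y n - u))\<^sup>2 - \<mu> / 4 * (s + 1) * (norm (y (Suc n) - u))\<^sup>2
        + 4 / (\<mu> * s) * (norm (g (Suc n) - g n))\<^sup>2
        - \<mu> / 4 * s * ((norm (x (Suc n) - y n))\<^sup>2 + (norm (x (Suc n) - y (Suc n)))\<^sup>2)"
      using strongly_convex_step[OF X \<mu> _ \<eta> xS y_def[of "Suc n"]] unfolding xh R_def s_def by simp
    have "(norm (g (Suc n) - g n))\<^sup>2 \<le> 4 * (e (Suc n) + L\<^sup>2 * q (Suc n) + d (Suc n) + e n)"
    proof -
      have "(norm (p (Suc n) (x (Suc n)) - p (Suc n) (x n)))\<^sup>2 \<le> (L * norm (x (Suc n) - x n))\<^sup>2"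
        using smooth[OF n] by (intro power_mono) auto
      then have "(norm (p (Suc n) (x (Suc n)) - p (Suc n) (x n)))\<^sup>2 \<le> L\<^sup>2 * q (Suc n)"
        by (simp add: q_def power_mult_distrib)
      moreover have "g (Suc n) - g n = (g (Suc n) - p (Suc n) (x (Suc n)))
          + (p (Suc n) (x (Suc n)) - p (Suc n) (x n)) + (p (Suc n) (x n) - p n (x n)) + (p n (x n) - g n)"
        by simp
      ultimately show ?thesis
        using norm_add4_power2_le[of "g (Suc n) - p (Suc n) (x (Suc n))"
            "p (Suc n) (x (Suc n)) - p (Suc n) (x n)" "p (Suc n) (x n) - p n (x n)" "p n (x n) - g n"]
        unfolding e_def d_def by (simp add: norm_minus_commute[of "g n"])
    qed
    then have "4 / (\<mu> * s) * (norm (g (Suc n) - g n))\<^sup>2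
        \<le> 4 / (\<mu> * s) * (4 * (e (Suc n) + L\<^sup>2 * q (Suc n) + d (Suc n) + e n))"
      using \<mu> s by (intro mult_left_mono) auto
    also have "\<dots> = 16 / (\<mu> * s) * (e (Suc n) + d (Suc n) + e n) + 16 * L\<^sup>2 / (\<mu> * s) * q (Suc n)"
      using \<mu> s by (simp add: field_simps)
    finally have 2: "4 / (\<mu> * s) * (norm (g (Suc n) - g n))\<^sup>2 \<le> \<dots>" .
    \<comment> \<open>The movement is routed through \<open>y n\<close>: the leg from
      \<open>x n\<close> is paid by the reserve of the previous round, the leg to
      \<open>x (Suc n)\<close> by the current round. The common coefficient is \<open>s - 1\<close>,
      the smaller of the two available.\<close>
    have "q (Suc n) \<le> 2 * (norm (x (Suc n) - y n))\<^sup>2 + 2 * (norm (x n - y n))\<^sup>2"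
      using norm_add2_power2_le[of "x (Suc n) - y n" "y n - x n"]
      by (simp add: q_def norm_minus_commute[of "y n"])
    then have "\<mu> * (s - 1) / 8 * q (Suc n)
        \<le> \<mu> * (s - 1) / 8 * (2 * (norm (x (Suc n) - y n))\<^sup>2 + 2 * (norm (x n - y n))\<^sup>2)"
      using \<mu> s by (intro mult_left_mono) auto
    also have "\<dots> = \<mu> / 4 * (s - 1) * (norm (x n - y n))\<^sup>2 + \<mu> / 4 * (s - 1) * (norm (x (Suc n) - y n))\<^sup>2"
      by (simp add: field_simps)
    also have "\<dots> \<le> \<mu> / 4 * (s - 1) * (norm (x n - y n))\<^sup>2 + \<mu> / 4 * s * (norm (x (Suc n) - y n))\<^sup>2"
      using \<mu> by (intro add_left_mono mult_right_mono) auto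
    finally have 3: "\<mu> * (s - 1) / 8 * q (Suc n) \<le> \<dots>" .
    have B: "B (Suc n) = 16 / (\<mu> * s) * (e (Suc n) + d (Suc n) + e n) + 16 * L\<^sup>2 / (\<mu> * s) * q (Suc n)
        - \<mu> * (s - 1) / 8 * q (Suc n)"
      by (simp add: B_def s_def algebra_simps)
    have IH: "sum R {1..n} \<le> \<mu> * D\<^sup>2 / 4 + 4 * G\<^sup>2 / \<mu> + sum B {2..n}
          - \<mu> / 4 * s * (norm (y n - u))\<^sup>2 - \<mu> / 4 * (s - 1) * (norm (x n - y n))\<^sup>2"
      using Suc by (simp add: s_def add.commute[of 1 "real n"])
    have "sum R {1..Suc n} = sum R {1..n} + R (Suc n)" "sum B {2..Suc n} = sum B {2..n} + B (Suc n)"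
      using Suc by auto
    moreover have "\<mu> / 4 * s * ((norm (x (Suc n) - y n))\<^sup>2 + (norm (x (Suc n) - y (Suc n)))\<^sup>2)
      = \<mu> / 4 * s * (norm (x (Suc n) - y n))\<^sup>2 + \<mu> / 4 * s * (norm (x (Suc n) - y (Suc n)))\<^sup>2"
      by (simp add: algebra_simps)
    ultimately show ?case using IH 1 2 3 B unfolding s_def[symmetric] by linarith
  qed
  from this[OF T order_refl] have "sum R {1..T} \<le> \<mu> * D\<^sup>2 / 4 + 4 * G\<^sup>2 / \<mu> + sum B {2..T}"
    using \<mu> by (smt (verit) mult_nonneg_nonneg of_nat_0_le_iff zero_le_power2 divide_nonneg_pos)
  moreover have "sum B {2..T} \<le> 16 * L\<^sup>2 * D\<^sup>2 / \<mu> * ln (1 + 8 * sqrt 2 * (L / \<mu>))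
      + (\<Sum>t=2..T. 16 / (\<mu> * real t) * (e t + d t + e (t - 1)))"
  proof -
    \<comment> \<open>The smoothness cost \<open>16 * L\<^sup>2 / (\<mu> * t)\<close> is covered by
      the credit \<open>\<mu> * (t - 1) / 8\<close> once
      \<open>128 * L\<^sup>2 \<le> \<mu>\<^sup>2 * t * (t - 1)\<close>, for which
      \<open>t - 1 \<ge> \<kappa>\<close> suffices since 128 is the square of
      \<open>8 * sqrt 2\<close>. In the earlier rounds the movement is bounded by the diameter
      instead.\<close>
    define \<kappa> where "\<kappa> = 8 * sqrt 2 * (L / \<mu>)"
    have \<kappa>0: "\<kappa> \<ge> 0" using L \<mu> by (simp add: \<kappa>_def)
    have "B t \<le> 16 * L\<^sup>2 * D\<^sup>2 / \<mu> * (if real t - 1 < \<kappa> then 1 / real t else 0)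
        + 16 / (\<mu> * real t) * (e t + d t + e (t - 1))" if t: "t \<in> {2..T}" for t
    proof -
      have q0: "q t \<ge> 0" by (simp add: q_def)
      have t0: "real t \<ge> 2" using t by auto
      have "(16 * L\<^sup>2 / (\<mu> * real t) - \<mu> * (real t - 1) / 8) * q t
        \<le> 16 * L\<^sup>2 * D\<^sup>2 / \<mu> * (if real t - 1 < \<kappa> then 1 / real t else 0)"
      proof (cases "real t - 1 < \<kappa>")
        case True
        have "norm (x t - x (t - 1)) \<le> D" using t by (intro diam xX) auto
        then have "q t \<le> D\<^sup>2" unfolding q_def by (intro power_mono) auto
        then have "16 * L\<^sup>2 / (\<mu> * real t) * q t \<le> 16 * L\<^sup>2 / (\<mu> * real t) * D\<^sup>2"
          using \<mu> by (intro mult_left_mono) auto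
        moreover have "\<mu> * (real t - 1) / 8 * q t \<ge> 0" using \<mu> t0 q0 by simp
        ultimately show ?thesis using True by (simp add: left_diff_distrib)
      next
        case False
        then have "(real t - 1) * \<mu> \<ge> 8 * sqrt 2 * L" using \<mu> by (simp add: \<kappa>_def field_simps)
        then have "(8 * sqrt 2 * L)\<^sup>2 \<le> ((real t - 1) * \<mu>)\<^sup>2" using L by (intro power_mono) auto
        then have "128 * L\<^sup>2 \<le> (real t - 1) * \<mu> * ((real t - 1) * \<mu>)"
          by (simp add: power_mult_distrib power2_eq_square[of "real t - 1"] power2_eq_square[of \<mu>] mult_ac)
        also have "\<dots> \<le> (real t - 1) * \<mu> * (real t * \<mu>)"
          using \<mu> t0 by (intro mult_left_mono mult_right_mono) auto
        finally have "16 * L\<^sup>2 / (\<mu> * real t) \<le> \<mu> * (real t - 1) / 8"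
          using \<mu> t0 by (simp add: field_simps)
        then show ?thesis using q0 False by (simp add: mult_nonpos_nonneg)
      qed
      then show ?thesis unfolding B_def by linarith
    qed
    then have "sum B {2..T} \<le> (\<Sum>t=2..T. 16 * L\<^sup>2 * D\<^sup>2 / \<mu> * (if real t - 1 < \<kappa> then 1 / real t else 0)
        + 16 / (\<mu> * real t) * (e t + d t + e (t - 1)))" by (rule sum_mono)
    also have "\<dots> = 16 * L\<^sup>2 * D\<^sup>2 / \<mu> * (\<Sum>t=2..T. if real t - 1 < \<kappa> then 1 / real t else 0)
        + (\<Sum>t=2..T. 16 / (\<mu> * real t) * (e t + d t + e (t - 1)))"
      by (simp add: sum.distrib sum_distrib_left)
    also have "\<dots> \<le> 16 * L\<^sup>2 * D\<^sup>2 / \<mu> * ln (1 + \<kappa>)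
        + (\<Sum>t=2..T. 16 / (\<mu> * real t) * (e t + d t + e (t - 1)))"
      using truncated_harmonic_le_ln[OF \<kappa>0, of T] \<mu> by (intro add_right_mono mult_left_mono) auto
    finally show ?thesis unfolding \<kappa>_def .
  qed
  ultimately show ?thesis unfolding R_def e_def d_def by linarith
qed

section \<open>Gradients of random losses\<close>

lemma GDERIV_unique: 
  fixes f :: "'a::real_inner \<Rightarrow> real"
  assumes "GDERIV f x :> g" "GDERIV f x :> g'" shows "g = g'"
proof -
  have "(\<lambda>h. inner h g) = (\<lambda>h. inner h g')"
    using assms unfolding gderiv_def by (rule has_derivative_unique)
  then have "inner (g - g') g = inner (g - g') g'" by metis
  then have "inner (g - g') (g - g') = 0" by (simp add: inner_diff_right)
  then show ?thesis by simp
qed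

lemma gradient_eqI: "GDERIV f x :> g \<Longrightarrow> gradient f x = g"
  unfolding gradient_def by (rule the_equality) (auto intro: GDERIV_unique)

lemma GDERIV_gradient: "\<exists>g. GDERIV f x :> g \<Longrightarrow> GDERIV f x :> gradient f x"
  using gradient_eqI by metis

text \<open>Full differentiability allows the evaluation points to leave the ray through
  \<open>x\<close> in direction \<open>v\<close>, as long as the rescaled displacement converges to
  \<open>v\<close>. This freedom is what permits rounding to a countable dense set.\<close>

lemma GDERIV_sequentially:
  fixes f :: "'a::real_inner \<Rightarrow> real" and r :: "nat \<Rightarrow> real"
  assumes f: "GDERIV f x :> g" and r0: "\<And>n. r n > 0" and r: "r \<longlonglongrightarrow> 0"
    and z: "(\<lambda>n. (1 / r n) *\<^sub>R (z n - x)) \<longlonglongrightarrow> v"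
  shows "(\<lambda>n. (f (z n) - f x) / r n) \<longlonglongrightarrow> inner v g"
proof -
  \<comment> \<open>The relative remainder, set to 0 at \<open>x\<close> and hence continuous there;
    the sequence may then hit \<open>x\<close> itself.\<close>
  define \<rho> where "\<rho> y = (if y = x then 0 else (f y - f x - inner (y - x) g) / norm (y - x))" for y
  have "(\<lambda>n. r n *\<^sub>R ((1 / r n) *\<^sub>R (z n - x))) \<longlonglongrightarrow> 0 *\<^sub>R v"
    by (rule tendsto_scaleR[OF r z])
  moreover have "r n \<noteq> 0" for n using r0[of n] by simp
  ultimately have "(\<lambda>n. z n - x) \<longlonglongrightarrow> 0" by simp
  then have zx: "z \<longlonglongrightarrow> x" by (simp add: LIM_zero_iff)
  have "(\<lambda>y. (f y - f x - inner (y - x) g) / norm (y - x)) \<midarrow>x\<rightarrow> 0"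
    using f unfolding gderiv_def has_derivative_at2 by (simp add: divide_inverse mult.commute diff_diff_eq)
  then have "\<rho> \<midarrow>x\<rightarrow> \<rho> x"
    by (rule Lim_transform_eventually[THEN tendsto_eq_rhs]) (auto simp: \<rho>_def eventually_at_filter)
  then have "isCont \<rho> x" by (simp add: isCont_def)
  then have "(\<lambda>n. \<rho> (z n)) \<longlonglongrightarrow> \<rho> x" using zx by (rule isCont_tendsto_compose)
  then have \<rho>: "(\<lambda>n. \<rho> (z n)) \<longlonglongrightarrow> 0" by (simp add: \<rho>_def)
  have "(\<lambda>n. inner ((1 / r n) *\<^sub>R (z n - x)) g + norm ((1 / r n) *\<^sub>R (z n - x)) * \<rho> (z n))
      \<longlonglongrightarrow> inner v g + norm v * 0"
    by (intro tendsto_intros z \<rho>)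
  moreover have "inner ((1 / r n) *\<^sub>R (z n - x)) g + norm ((1 / r n) *\<^sub>R (z n - x)) * \<rho> (z n)
      = (f (z n) - f x) / r n" for n
  proof -
    have "norm ((1 / r n) *\<^sub>R (z n - x)) = norm (z n - x) / r n" using r0[of n] by simp
    moreover have "inner ((1 / r n) *\<^sub>R (z n - x)) g = inner (z n - x) g / r n" by simp
    ultimately show ?thesis using r0[of n] by (cases "z n = x") (simp_all only: \<rho>_def, simp_all add: field_simps)
  qed
  ultimately show ?thesis by simp
qed


lemma dense_sequence:
  obtains c :: "nat \<Rightarrow> 'a::euclidean_space"
  where "\<And>x e. e > 0 \<Longrightarrow> \<exists>n. dist (c n) x < e"
proof -
  obtain S :: "'a set" where S: "countable S" "\<And>U. open U \<Longrightarrow> U \<noteq> {} \<Longrightarrow> \<exists>d\<in>S. d \<in> U"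
    using countable_dense_setE by blast
  have "\<exists>n. dist (from_nat_into S n) x < e" if e: "e > 0" for x e
  proof -
    have "ball x e \<noteq> {}" using e by simp
    then obtain d where "d \<in> S" "d \<in> ball x e" using S(2)[of "ball x e"] by auto
    then show ?thesis using from_nat_into_surj[OF S(1), of d] by (auto simp: dist_commute)
  qed
  then show ?thesis using that by blast
qed

lemma loss_eval_measurable: "(\<lambda>f. f z) \<in> borel_measurable (loss_space X)"
  unfolding loss_space_def by (intro measurable_restrict_space1 measurable_component_singleton) simp

lemma space_loss_space: "space (loss_space X) = {f. \<forall>x\<in>X. \<exists>g. GDERIV f x :> g}"
  by (auto simp: loss_space_def space_restrict_space space_PiM)

text \<open>Point evaluations are the only measurable functions given on losses, and the iterates
  are random points. A countably-valued random point reduces evaluation to the fixed points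
  \<open>c k\<close>; values and gradient coordinates at \<open>y w\<close> are then limits of such
  evaluations.\<close>

lemma
  fixes X :: "'a::euclidean_space set"
  assumes h: "h \<in> N \<rightarrow>\<^sub>M loss_space X" and y: "y \<in> borel_measurable N"
    and yX: "\<And>w. w \<in> space N \<Longrightarrow> y w \<in> X"
  shows loss_apply_measurable: "(\<lambda>w. h w (y w)) \<in> borel_measurable N"
    and gradient_apply_measurable: "(\<lambda>w. gradient (h w) (y w)) \<in> borel_measurable N"
proof -
  obtain c :: "nat \<Rightarrow> 'a" where c: "\<And>x e. e > 0 \<Longrightarrow> \<exists>n. dist (c n) x < e"
    using dense_sequence by blast
  note y [measurable]
  define r where "r n = 1 / real (Suc n)" for n
  have r0: "r n > 0" for n by (simp add: r_def)
  have r: "r \<longlonglongrightarrow> 0" unfolding r_def by (rule LIMSEQ_Suc[OF lim_1_over_n])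
  txt \<open>Losses are arbitrary off \<open>X\<close>, so they can only be evaluated measurably at countably many points.
    Rounding \<open>y w + r n *\<^sub>R v\<close> with error \<open>(r n)\<^sup>2\<close> does not change the limit of the difference quotient.\<close>
  define z where "z v n w = c (LEAST k. dist (c k) (y w + r n *\<^sub>R v) < (r n)\<^sup>2)" for v n w
  have zd: "dist (z v n w) (y w + r n *\<^sub>R v) < (r n)\<^sup>2" for v n w
    unfolding z_def by (rule LeastI_ex) (use c r0[of n] in simp)
  have hz: "(\<lambda>w. h w (z v n w)) \<in> borel_measurable N" for v n
    unfolding z_def
  proof (rule measurable_compose_countable)
    show "(\<lambda>w. h w (c k)) \<in> borel_measurable N" for k
      by (rule measurable_compose[OF h loss_eval_measurable])
    show "(\<lambda>w. LEAST k. dist (c k) (y w + r n *\<^sub>R v) < (r n)\<^sup>2) \<in> N \<rightarrow>\<^sub>M count_space UNIV"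
      by measurable
  qed
  have GD: "GDERIV (h w) (y w) :> gradient (h w) (y w)" if "w \<in> space N" for w
    using measurable_space[OF h that] yX[OF that] by (intro GDERIV_gradient) (auto simp: space_loss_space)
  have lim: "(\<lambda>n. (h w (z v n w) - h w (y w)) / r n) \<longlonglongrightarrow> inner v (gradient (h w) (y w))"
    if w: "w \<in> space N" for v w
  proof (rule GDERIV_sequentially[OF GD[OF w] r0 r])
    have "(\<lambda>n. (1 / r n) *\<^sub>R (z v n w - y w) - v) \<longlonglongrightarrow> 0"
    proof (rule tendsto_norm_zero_cancel, rule tendsto_sandwich[OF _ _ tendsto_const r])
      have "norm ((1 / r n) *\<^sub>R (z v n w - y w) - v) \<le> r n" for n
      proof -
        have "(1 / r n) *\<^sub>R (z v n w - y w) - v = (1 / r n) *\<^sub>R (z v n w - (y w + r n *\<^sub>R v))"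
          using r0[of n] by (simp add: algebra_simps)
        then have "norm ((1 / r n) *\<^sub>R (z v n w - y w) - v) = dist (z v n w) (y w + r n *\<^sub>R v) / r n"
          using r0[of n] by (simp add: dist_norm)
        also have "\<dots> \<le> (r n)\<^sup>2 / r n" using zd[of v n w] r0[of n] by (intro divide_right_mono) auto
        finally show ?thesis using r0[of n] by (simp add: power2_eq_square)
      qed
      then show "\<forall>\<^sub>F n in sequentially. norm ((1 / r n) *\<^sub>R (z v n w - y w) - v) \<le> r n" by simp
    qed simp
    then show "(\<lambda>n. (1 / r n) *\<^sub>R (z v n w - y w)) \<longlonglongrightarrow> v" by (simp add: LIM_zero_iff)
  qed
  \<comment> \<open>Direction 0 makes the rounded points converge to \<open>y w\<close> itself. The
    limit of the quotients, multiplied by \<open>r n\<close>, then gives convergence of the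
    values.\<close>
  show hy [measurable]: "(\<lambda>w. h w (y w)) \<in> borel_measurable N"
  proof (rule borel_measurable_LIMSEQ_real[OF _ hz[of 0]])
    fix w assume w: "w \<in> space N"
    have "(\<lambda>n. h w (y w) + r n * ((h w (z 0 n w) - h w (y w)) / r n)) \<longlonglongrightarrow>
        h w (y w) + 0 * inner 0 (gradient (h w) (y w))"
      by (intro tendsto_intros r lim w)
    moreover have "h w (y w) + r n * ((h w (z 0 n w) - h w (y w)) / r n) = h w (z 0 n w)" for n
      using r0[of n] by simp
    ultimately show "(\<lambda>n. h w (z 0 n w)) \<longlonglongrightarrow> h w (y w)" by simp
  qed
  have "(\<lambda>w. gradient (h w) (y w) \<bullet> i) \<in> borel_measurable N" for i
  proof (rule borel_measurable_LIMSEQ_real)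
    show "(\<lambda>w. (h w (z i n w) - h w (y w)) / r n) \<in> borel_measurable N" for n
      using hz[of i n] by measurable
    show "(\<lambda>n. (h w (z i n w) - h w (y w)) / r n) \<longlonglongrightarrow> gradient (h w) (y w) \<bullet> i"
      if "w \<in> space N" for w using lim[OF that, of i] by (simp add: inner_commute)
  qed
  then show "(\<lambda>w. gradient (h w) (y w)) \<in> borel_measurable N"
    by (subst borel_measurable_euclidean_space) auto
qed

text \<open>The mean value inequality on the convex domain. It supplies the domination under which
  differences of losses are integrable, although no bound on the losses themselves is
  available.\<close>

lemma GDERIV_bounded_lipschitz:
  fixes f :: "'a::real_inner \<Rightarrow> real"
  assumes "convex X" and f: "\<And>x. x \<in> X \<Longrightarrow> \<exists>g. GDERIV f x :> g"
    and G: "\<And>x. x \<in> X \<Longrightarrow> norm (gradient f x) \<le> G" and xy: "x \<in> X" "y \<in> X"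
  shows "\<bar>f x - f y\<bar> \<le> G * norm (x - y)"
proof -
  have "norm (f x - f y) \<le> G * norm (x - y)"
  proof (rule differentiable_bound[OF assms(1) _ _ xy])
    show "(f has_derivative (\<lambda>h. inner h (gradient f z))) (at z within X)" if "z \<in> X" for z
      using GDERIV_gradient[OF f[OF that]] unfolding gderiv_def by (rule has_derivative_at_withinI)
    show "onorm (\<lambda>h. inner h (gradient f z)) \<le> G" if "z \<in> X" for z
    proof (rule onorm_bound)
      show "0 \<le> G" using G[OF that] norm_ge_zero order_trans by blast
      fix h
      have "norm (inner h (gradient f z)) \<le> norm h * norm (gradient f z)"
        using Cauchy_Schwarz_ineq2[of h "gradient f z"] by simp
      also have "\<dots> \<le> norm h * G" using G[OF that] by (intro mult_left_mono) auto
      finally show "norm (inner h (gradient f z)) \<le> G * norm h" by (simp add: mult.commute)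
    qed
  qed
  then show ?thesis by simp
qed

text \<open>The defining inequality on the segment from \<open>x\<close> to \<open>u\<close>,
  divided by the segment parameter \<open>r n\<close>, becomes the first-order inequality as
  \<open>r n\<close> tends to 0.\<close>

lemma strongly_convex_on_first_order:
  fixes F :: "'a::real_inner \<Rightarrow> real"
  assumes sc: "strongly_convex_on X \<mu> F" and g: "GDERIV F x :> g" and x: "x \<in> X" and u: "u \<in> X"
  shows "F x - F u \<le> inner g (x - u) - \<mu> / 2 * (norm (x - u))\<^sup>2"
proof -
  define r where "r n = 1 / real (Suc n)" for n
  have r0: "r n > 0" "r n \<le> 1" for n by (simp_all add: r_def)
  have r: "r \<longlonglongrightarrow> 0" unfolding r_def by (rule LIMSEQ_Suc[OF lim_1_over_n])
  have "(\<lambda>n. (F (x + r n *\<^sub>R (u - x)) - F x) / r n) \<longlonglongrightarrow> inner (u - x) g"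
  proof (rule GDERIV_sequentially[OF g r0(1) r])
    have "(1 / r n) *\<^sub>R (x + r n *\<^sub>R (u - x) - x) = u - x" for n using r0(1)[of n] by simp
    then show "(\<lambda>n. (1 / r n) *\<^sub>R (x + r n *\<^sub>R (u - x) - x)) \<longlonglongrightarrow> u - x" by simp
  qed
  moreover have "(\<lambda>n. F u - F x - \<mu> / 2 * (1 - r n) * (norm (x - u))\<^sup>2)
      \<longlonglongrightarrow> F u - F x - \<mu> / 2 * (1 - 0) * (norm (x - u))\<^sup>2"
    by (intro tendsto_intros r)
  moreover have "(F (x + r n *\<^sub>R (u - x)) - F x) / r n \<le> F u - F x - \<mu> / 2 * (1 - r n) * (norm (x - u))\<^sup>2" for n
  proof -
    have "F (r n *\<^sub>R u + (1 - r n) *\<^sub>R x)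
        \<le> r n * F u + (1 - r n) * F x - \<mu> / 2 * r n * (1 - r n) * (norm (u - x))\<^sup>2"
      using sc x u r0[of n] unfolding strongly_convex_on_def by auto
    also have "r n *\<^sub>R u + (1 - r n) *\<^sub>R x = x + r n *\<^sub>R (u - x)" by (simp add: algebra_simps)
    finally have "F (x + r n *\<^sub>R (u - x)) - F x \<le> r n * (F u - F x - \<mu> / 2 * (1 - r n) * (norm (x - u))\<^sup>2)"
      by (simp add: algebra_simps norm_minus_commute)
    then show ?thesis using r0[of n] by (simp add: divide_le_eq mult.commute)
  qed
  ultimately have "inner (u - x) g \<le> F u - F x - \<mu> / 2 * (1 - 0) * (norm (x - u))\<^sup>2"
    by (intro LIMSEQ_le) auto
  then show ?thesis by (simp add: inner_commute algebra_simps)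
qed

section \<open>Conditional laws and kernels\<close>

text \<open>On a rectangle \<open>A \<times> B\<close> with \<open>A\<close> in the past, both sides
  are the integral over \<open>A\<close> of the conditional probability of \<open>B\<close>, and
  rectangles form an intersection-stable generator. Comparing measures in this way avoids a common
  exceptional set for all events. The measure
  \<open>distr (K w) (F \<Otimes>\<^sub>M N) (Pair w)\<close> is the product of the point mass at
  \<open>w\<close> with \<open>K w\<close>.\<close>

lemma joint_law_eq_bind:
  assumes M: "prob_space M" and sub: "subalgebra M F"
    and K: "K \<in> F \<rightarrow>\<^sub>M prob_algebra N" and Y: "Y \<in> M \<rightarrow>\<^sub>M N"
    and law: "\<And>A. A \<in> sets N \<Longrightarrow>
      AE w in M. real_cond_exp M F (\<lambda>w. indicator A (Y w)) w = measure (K w) A"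
  shows "distr M (F \<Otimes>\<^sub>M N) (\<lambda>w. (w, Y w)) =
    restr_to_subalg M F \<bind> (\<lambda>w. distr (K w) (F \<Otimes>\<^sub>M N) (Pair w))"
proof -
  interpret prob_space M by fact
  interpret finite_measure_subalgebra M F by unfold_locales (rule sub)
  interpret sigma_finite_subalgebra M F
    by (rule finite_measure_subalgebra_is_sigma_finite) unfold_locales
  let ?R = "restr_to_subalg M F"
  have R: "measurable ?R = measurable F"
    by (intro ext measurable_cong_sets sets_restr_to_subalg[OF sub] refl)
  have sp: "space F = space M" "space ?R = space M" using sub by (auto simp: subalgebra_def space_restr_to_subalg)
  have KF [measurable]: "K \<in> F \<rightarrow>\<^sub>M subprob_algebra N" by (rule measurable_prob_algebraD[OF K])
  have KP: "prob_space (K w)" "sets (K w) = sets N" if "w \<in> space M" for w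
    using measurable_space[OF K, of w] that sp by (auto simp: space_prob_algebra)
  have idF: "(\<lambda>w. w) \<in> M \<rightarrow>\<^sub>M F" using sub by (rule measurable_from_subalg) simp
  have pair: "(\<lambda>w. (w, Y w)) \<in> M \<rightarrow>\<^sub>M F \<Otimes>\<^sub>M N" using idF Y by (intro measurable_Pair)
  have D: "(\<lambda>w. distr (K w) (F \<Otimes>\<^sub>M N) (Pair w)) \<in> ?R \<rightarrow>\<^sub>M subprob_algebra (F \<Otimes>\<^sub>M N)"
    unfolding R by (rule measurable_distr2[OF _ KF]) simp
  let ?E = "{a \<times> b | a b. a \<in> sets F \<and> b \<in> sets N}"
  have ne: "space ?R \<noteq> {}" using not_empty sp by simp
  show ?thesis
  proof (rule measure_eqI_generator_eq[OF Int_stable_pair_measure_generator[of F N]])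
    show "?E \<subseteq> Pow (space F \<times> space N)"
      using sets.space_closed[of F] sets.space_closed[of N] by auto
    show "sets (distr M (F \<Otimes>\<^sub>M N) (\<lambda>w. (w, Y w))) = sigma_sets (space F \<times> space N) ?E"
      by (simp add: sets_pair_measure)
    show "sets (?R \<bind> (\<lambda>w. distr (K w) (F \<Otimes>\<^sub>M N) (Pair w))) = sigma_sets (space F \<times> space N) ?E"
      using sets_bind[of ?R _ "F \<Otimes>\<^sub>M N"] ne by (simp add: sets_pair_measure)
    show "range (\<lambda>_::nat. space F \<times> space N) \<subseteq> ?E" by auto
    show "(\<Union>_::nat. space F \<times> space N) = space F \<times> space N" by simp
    show "emeasure (distr M (F \<Otimes>\<^sub>M N) (\<lambda>w. (w, Y w))) (space F \<times> space N) \<noteq> \<infinity>"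
      using pair by (subst emeasure_distr) auto
  next
    fix C assume "C \<in> ?E"
    then obtain A B where C: "C = A \<times> B" and A: "A \<in> sets F" and B [measurable]: "B \<in> sets N" by auto
    have AM [measurable]: "A \<in> sets M" using A sub by (auto simp: subalgebra_def)
    note Y [measurable]
    have KM [measurable]: "K \<in> M \<rightarrow>\<^sub>M subprob_algebra N" using sub KF by (rule measurable_from_subalg)
    have mK: "(\<lambda>w. measure (K w) B) \<in> borel_measurable M" by measurable
    have int: "integrable M (\<lambda>w. indicator B (Y w) :: real)"
      by (intro integrable_const_bound[of _ 1]) (auto simp: indicator_def)
    have "emeasure (distr M (F \<Otimes>\<^sub>M N) (\<lambda>w. (w, Y w))) C = emeasure M ((\<lambda>w. (w, Y w)) -` C \<inter> space M)"
      using pair A B by (subst emeasure_distr) (auto simp: C)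
    also have "(\<lambda>w. (w, Y w)) -` C \<inter> space M = A \<inter> (Y -` B \<inter> space M)" by (auto simp: C)
    also have "emeasure M \<dots> = ennreal (LINT w|M. indicator (A \<inter> (Y -` B \<inter> space M)) w)"
      by (simp add: emeasure_eq_measure)
    also have "(LINT w|M. indicator (A \<inter> (Y -` B \<inter> space M)) w :: real) = (LINT w:A|M. indicator B (Y w))"
      unfolding set_lebesgue_integral_def by (intro Bochner_Integration.integral_cong) (auto simp: indicator_def)
    also have "\<dots> = (LINT w:A|M. real_cond_exp M F (\<lambda>w. indicator B (Y w)) w)"
      by (rule real_cond_exp_intA[OF int A])
    also have "\<dots> = (LINT w:A|M. measure (K w) B)"
      using law[OF B] mK by (intro set_lebesgue_integral_cong_AE) auto
    also have "ennreal \<dots> = (\<integral>\<^sup>+w. ennreal (indicator A w * measure (K w) B) \<partial>M)"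
      unfolding set_lebesgue_integral_def real_scaleR_def
    proof (rule nn_integral_eq_integral[symmetric])
      show "integrable M (\<lambda>w. indicator A w * measure (K w) B)"
        using mK KP(1) by (intro integrable_const_bound[of _ 1])
          (auto simp: indicator_def prob_space.prob_le_1)
    qed auto
    also have "\<dots> = (\<integral>\<^sup>+w. emeasure (distr (K w) (F \<Otimes>\<^sub>M N) (Pair w)) C \<partial>M)"
    proof (rule nn_integral_cong)
      fix w assume w: "w \<in> space M"
      interpret K: prob_space "K w" by (rule KP(1)[OF w])
      have "Pair w \<in> K w \<rightarrow>\<^sub>M F \<Otimes>\<^sub>M N"
        using w sp KP(2)[OF w] by (simp cong: measurable_cong_sets)
      then have "emeasure (distr (K w) (F \<Otimes>\<^sub>M N) (Pair w)) C = emeasure (K w) (Pair w -` C \<inter> space (K w))"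
        using A B by (subst emeasure_distr) (auto simp: C)
      also have "Pair w -` C \<inter> space (K w) = (if w \<in> A then B else {})"
        using sets.sets_into_space[OF B] sets_eq_imp_space_eq[OF KP(2)[OF w]] by (auto simp: C)
      finally show "ennreal (indicator A w * measure (K w) B) = emeasure (distr (K w) (F \<Otimes>\<^sub>M N) (Pair w)) C"
        by (simp add: indicator_def K.emeasure_eq_measure)
    qed
    also have "\<dots> = (\<integral>\<^sup>+w. emeasure (distr (K w) (F \<Otimes>\<^sub>M N) (Pair w)) C \<partial>?R)"
    proof (rule nn_integral_subalgebra2[OF sub, symmetric])
      have "C \<in> sets (F \<Otimes>\<^sub>M N)" using A B by (auto simp: C)
      then show "(\<lambda>w. emeasure (distr (K w) (F \<Otimes>\<^sub>M N) (Pair w)) C) \<in> borel_measurable F"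
        using measurable_emeasure_kernel[OF D] unfolding R by blast
    qed
    also have "\<dots> = emeasure (?R \<bind> (\<lambda>w. distr (K w) (F \<Otimes>\<^sub>M N) (Pair w))) C"
      using A B by (intro emeasure_bind[OF ne D, symmetric]) (auto simp: C)
    finally show "emeasure (distr M (F \<Otimes>\<^sub>M N) (\<lambda>w. (w, Y w))) C
      = emeasure (?R \<bind> (\<lambda>w. distr (K w) (F \<Otimes>\<^sub>M N) (Pair w))) C" .
  qed
qed

text \<open>The identity of joint laws extends the hypothesis from single events to every jointly
  measurable integrand, in particular to those that see the past through \<open>w\<close>.\<close>

lemma nn_integral_conditional_law:
  assumes M: "prob_space M" and sub: "subalgebra M F"
    and K: "K \<in> F \<rightarrow>\<^sub>M prob_algebra N" and Y: "Y \<in> M \<rightarrow>\<^sub>M N"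
    and law: "\<And>A. A \<in> sets N \<Longrightarrow>
      AE w in M. real_cond_exp M F (\<lambda>w. indicator A (Y w)) w = measure (K w) A"
    and h: "case_prod h \<in> borel_measurable (F \<Otimes>\<^sub>M N)"
  shows "(\<integral>\<^sup>+w. h w (Y w) \<partial>M) = (\<integral>\<^sup>+w. (\<integral>\<^sup>+y. h w y \<partial>K w) \<partial>M)"
proof -
  let ?R = "restr_to_subalg M F"
  have R: "measurable ?R = measurable F"
    by (intro ext measurable_cong_sets sets_restr_to_subalg[OF sub] refl)
  have sp: "space F = space M" using sub by (auto simp: subalgebra_def)
  have KF: "K \<in> F \<rightarrow>\<^sub>M subprob_algebra N" by (rule measurable_prob_algebraD[OF K])
  have D: "(\<lambda>w. distr (K w) (F \<Otimes>\<^sub>M N) (Pair w)) \<in> ?R \<rightarrow>\<^sub>M subprob_algebra (F \<Otimes>\<^sub>M N)"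
    unfolding R by (rule measurable_distr2[OF _ KF]) simp
  have idF: "(\<lambda>w. w) \<in> M \<rightarrow>\<^sub>M F" using sub by (rule measurable_from_subalg) simp
  have pair: "(\<lambda>w. (w, Y w)) \<in> M \<rightarrow>\<^sub>M F \<Otimes>\<^sub>M N" using idF Y by (intro measurable_Pair)
  have "(\<integral>\<^sup>+w. h w (Y w) \<partial>M) = (\<integral>\<^sup>+z. case_prod h z \<partial>distr M (F \<Otimes>\<^sub>M N) (\<lambda>w. (w, Y w)))"
    using h by (subst nn_integral_distr[OF pair]) auto
  also have "\<dots> = (\<integral>\<^sup>+w. (\<integral>\<^sup>+z. case_prod h z \<partial>distr (K w) (F \<Otimes>\<^sub>M N) (Pair w)) \<partial>?R)"
    by (subst joint_law_eq_bind[OF M sub K Y law], assumption, rule nn_integral_bind[OF h D])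
  also have "\<dots> = (\<integral>\<^sup>+w. (\<integral>\<^sup>+z. case_prod h z \<partial>distr (K w) (F \<Otimes>\<^sub>M N) (Pair w)) \<partial>M)"
    using measurable_compose[OF D nn_integral_measurable_subprob_algebra[OF h]]
    by (intro nn_integral_subalgebra2[OF sub]) (simp add: R)
  also have "\<dots> = (\<integral>\<^sup>+w. (\<integral>\<^sup>+y. h w y \<partial>K w) \<partial>M)"
  proof (rule nn_integral_cong)
    fix w assume w: "w \<in> space M"
    then have "Pair w \<in> K w \<rightarrow>\<^sub>M F \<Otimes>\<^sub>M N"
      using sp subprob_measurableD(2)[OF KF, of w] by (simp cong: measurable_cong_sets)
    then show "(\<integral>\<^sup>+z. case_prod h z \<partial>distr (K w) (F \<Otimes>\<^sub>M N) (Pair w)) = (\<integral>\<^sup>+y. h w y \<partial>K w)"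
      using h by (subst nn_integral_distr) auto
  qed
  finally show ?thesis .
qed

text \<open>The failure set of \<open>P\<close> is null for the joint law, so its conditional
  probabilities integrate to 0. This carries an almost sure bound on the sampled value over to the
  kernel, where integrability is needed as well.\<close>

lemma AE_conditional_law:
  assumes M: "prob_space M" and sub: "subalgebra M F"
    and K: "K \<in> F \<rightarrow>\<^sub>M prob_algebra N" and Y: "Y \<in> M \<rightarrow>\<^sub>M N"
    and law: "\<And>A. A \<in> sets N \<Longrightarrow>
      AE w in M. real_cond_exp M F (\<lambda>w. indicator A (Y w)) w = measure (K w) A"
    and P [measurable]: "Measurable.pred (F \<Otimes>\<^sub>M N) (case_prod P)"
    and AE: "AE w in M. P w (Y w)"
  shows "AE w in M. AE y in K w. P w y"
proof -
  have sp: "space F = space M" using sub by (auto simp: subalgebra_def)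
  have KF: "K \<in> F \<rightarrow>\<^sub>M subprob_algebra N" by (rule measurable_prob_algebraD[OF K])
  define h where "h w y = (if P w y then 0 else 1 :: ennreal)" for w y
  have h: "case_prod h \<in> borel_measurable (F \<Otimes>\<^sub>M N)"
  proof -
    have "(\<lambda>z. if case_prod P z then 0 else 1 :: ennreal) \<in> borel_measurable (F \<Otimes>\<^sub>M N)" by measurable
    then show ?thesis by (simp add: h_def case_prod_beta' cong: measurable_cong_sets)
  qed
  have "(\<integral>\<^sup>+w. (\<integral>\<^sup>+y. h w y \<partial>K w) \<partial>M) = (\<integral>\<^sup>+w. h w (Y w) \<partial>M)"
    by (rule nn_integral_conditional_law[OF M sub K Y law h, symmetric])
  also have "\<dots> = (\<integral>\<^sup>+w. 0 \<partial>M)" using AE by (intro nn_integral_cong_AE) (auto simp: h_def)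
  finally have "(\<integral>\<^sup>+w. (\<integral>\<^sup>+y. h w y \<partial>K w) \<partial>M) = 0" by simp
  moreover have "(\<lambda>w. \<integral>\<^sup>+y. h w y \<partial>K w) \<in> borel_measurable M"
    using nn_integral_measurable_subprob_algebra2[of h F N K] h KF
    by (intro measurable_from_subalg[OF sub]) (auto simp: case_prod_beta')
  ultimately have "AE w in M. (\<integral>\<^sup>+y. h w y \<partial>K w) = 0" by (simp add: nn_integral_0_iff_AE)
  then show ?thesis using AE_space
  proof eventually_elim
    case (elim w)
    have "h w \<in> borel_measurable N" using measurable_Pair2[OF h, of w] elim sp by simp
    then have "h w \<in> borel_measurable (K w)" using subprob_measurableD(2)[OF KF, of w] elim sp by (simp cong: measurable_cong_sets)
    then have "AE y in K w. h w y = 0" using elim by (simp add: nn_integral_0_iff_AE)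
    then show ?case by (rule AE_mp) (auto simp: h_def split: if_splits)
  qed
qed

text \<open>Pushing \<open>K w\<close> forward along \<open>Pair w\<close> moves the dependence on
  \<open>w\<close> from the integrand into the measure, so that a fixed function on the product
  space is integrated.\<close>

lemma integral_kernel_measurable:
  fixes h :: "'a \<Rightarrow> 'b \<Rightarrow> 'c::{banach, second_countable_topology}"
  assumes K: "K \<in> F \<rightarrow>\<^sub>M subprob_algebra N" and h: "case_prod h \<in> borel_measurable (F \<Otimes>\<^sub>M N)"
  shows "(\<lambda>w. LINT y|K w. h w y) \<in> borel_measurable F"
proof -
  have D: "(\<lambda>w. distr (K w) (F \<Otimes>\<^sub>M N) (Pair w)) \<in> F \<rightarrow>\<^sub>M subprob_algebra (F \<Otimes>\<^sub>M N)"
    by (rule measurable_distr2[OF _ K]) simp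
  have "(\<lambda>w. LINT z|distr (K w) (F \<Otimes>\<^sub>M N) (Pair w). case_prod h z) \<in> borel_measurable F"
    by (rule measurable_compose[OF D integral_measurable_subprob_algebra[OF h]])
  then show ?thesis
  proof (rule measurable_cong[THEN iffD1, rotated])
    fix w assume w: "w \<in> space F"
    then have "Pair w \<in> K w \<rightarrow>\<^sub>M F \<Otimes>\<^sub>M N"
      using subprob_measurableD(2)[OF K, of w] by (simp cong: measurable_cong_sets)
    then show "(LINT z|distr (K w) (F \<Otimes>\<^sub>M N) (Pair w). case_prod h z) = (LINT y|K w. h w y)"
      using h by (subst integral_distr) auto
  qed
qed

text \<open>Adding \<open>B\<close> makes the integrand nonnegative almost everywhere, both at the
  sampled value and under the kernel, and reduces the claim to the nonnegative case; on probability
  spaces the shift then cancels.\<close>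

lemma integral_conditional_law:
  fixes h :: "'a \<Rightarrow> 'b \<Rightarrow> real"
  assumes M: "prob_space M" and sub: "subalgebra M F"
    and K: "K \<in> F \<rightarrow>\<^sub>M prob_algebra N" and Y: "Y \<in> M \<rightarrow>\<^sub>M N"
    and law: "\<And>A. A \<in> sets N \<Longrightarrow>
      AE w in M. real_cond_exp M F (\<lambda>w. indicator A (Y w)) w = measure (K w) A"
    and h: "case_prod h \<in> borel_measurable (F \<Otimes>\<^sub>M N)"
    and bound: "AE w in M. \<bar>h w (Y w)\<bar> \<le> B"
  shows "integrable M (\<lambda>w. h w (Y w))" "integrable M (\<lambda>w. LINT y|K w. h w y)"
    and "(LINT w|M. h w (Y w)) = (LINT w|M. LINT y|K w. h w y)"
proof -
  interpret prob_space M by fact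
  have sp: "space F = space M" using sub by (auto simp: subalgebra_def)
  have KF: "K \<in> F \<rightarrow>\<^sub>M subprob_algebra N" by (rule measurable_prob_algebraD[OF K])
  have idF: "(\<lambda>w. w) \<in> M \<rightarrow>\<^sub>M F" using sub by (rule measurable_from_subalg) simp
  have pair: "(\<lambda>w. (w, Y w)) \<in> M \<rightarrow>\<^sub>M F \<Otimes>\<^sub>M N" using idF Y by (intro measurable_Pair)
  have hY: "(\<lambda>w. h w (Y w)) \<in> borel_measurable M" using measurable_compose[OF pair h] by simp
  then show int: "integrable M (\<lambda>w. h w (Y w))"
    using bound by (intro integrable_const_bound[of _ B]) auto
  have P: "Measurable.pred (F \<Otimes>\<^sub>M N) (\<lambda>(w, y). \<bar>h w y\<bar> \<le> B)"
    using h by (simp add: case_prod_beta')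
  have bK: "AE w in M. AE y in K w. \<bar>h w y\<bar> \<le> B"
    by (rule AE_conditional_law[OF M sub K Y law P bound])
  have hK: "(\<lambda>w. LINT y|K w. h w y) \<in> borel_measurable M"
    by (rule measurable_from_subalg[OF sub integral_kernel_measurable[OF KF h]])
  have K1: "AE w in M. prob_space (K w) \<and> h w \<in> borel_measurable (K w)"
    using AE_space
  proof eventually_elim
    case (elim w)
    have "h w \<in> borel_measurable N" using measurable_Pair2[OF h, of w] elim sp by simp
    then show ?case using measurable_space[OF K, of w] elim sp
      by (auto simp: space_prob_algebra cong: measurable_cong_sets)
  qed
  have inner: "AE w in M. \<bar>LINT y|K w. h w y\<bar> \<le> B
      \<and> (\<integral>\<^sup>+y. ennreal (h w y + B) \<partial>K w) = ennreal ((LINT y|K w. h w y) + B)"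
    using bK K1
  proof eventually_elim
    case (elim w)
    interpret K: prob_space "K w" using elim by simp
    have i: "integrable (K w) (h w)" using elim by (intro K.integrable_const_bound[of _ B]) auto
    have "\<bar>LINT y|K w. h w y\<bar> \<le> (LINT y|K w. \<bar>h w y\<bar>)" by (rule integral_abs_bound)
    also have "\<dots> \<le> B" using i elim by (intro K.integral_le_const) auto
    finally have "\<bar>LINT y|K w. h w y\<bar> \<le> B" .
    moreover have "(\<integral>\<^sup>+y. ennreal (h w y + B) \<partial>K w) = ennreal (LINT y|K w. h w y + B)"
      using i elim by (intro nn_integral_eq_integral) (auto elim: AE_mp)
    ultimately show ?case using i by (simp add: K.prob_space)
  qed
  then show intK: "integrable M (\<lambda>w. LINT y|K w. h w y)"
    using hK by (intro integrable_const_bound[of _ B]) auto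
  have "ennreal (LINT w|M. h w (Y w) + B) = (\<integral>\<^sup>+w. ennreal (h w (Y w) + B) \<partial>M)"
    using int bound by (intro nn_integral_eq_integral[symmetric]) auto
  also have "\<dots> = (\<integral>\<^sup>+w. (\<integral>\<^sup>+y. ennreal (h w y + B) \<partial>K w) \<partial>M)"
    using h by (intro nn_integral_conditional_law[OF M sub K Y law]) (auto simp: case_prod_beta')
  also have "\<dots> = (\<integral>\<^sup>+w. ennreal ((LINT y|K w. h w y) + B) \<partial>M)"
    using inner by (intro nn_integral_cong_AE) auto
  also have "\<dots> = ennreal (LINT w|M. (LINT y|K w. h w y) + B)"
    using intK inner by (intro nn_integral_eq_integral) auto
  finally have "ennreal (LINT w|M. h w (Y w) + B) = ennreal (LINT w|M. (LINT y|K w. h w y) + B)" .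
  moreover have "0 \<le> (LINT w|M. h w (Y w) + B)" using bound by (intro integral_nonneg_AE) auto
  moreover have "0 \<le> (LINT w|M. (LINT y|K w. h w y) + B)" using inner by (intro integral_nonneg_AE) auto
  ultimately show "(LINT w|M. h w (Y w)) = (LINT w|M. LINT y|K w. h w y)"
    using int intK by (simp add: prob_space)
qed

section \<open>Expected regret in the stochastically extended adversarial model\<close>

text \<open>Dividing by the per-round bound \<open>m\<close> normalizes the terms to the unit
  interval, where the weighted sum is logarithmic.\<close>

lemma noise_sum_le_ln:
  fixes b :: "nat \<Rightarrow> real"
  assumes m: "m > 0" and \<mu>: "\<mu> > 0" and b: "\<And>t. t \<in> {2..T} \<Longrightarrow> 0 \<le> b t \<and> b t \<le> m"
    and S: "(\<Sum>t=2..T. b t) \<le> S"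
  shows "(\<Sum>t=2..T. 16 / (\<mu> * real t) * b t) \<le> 16 * m / \<mu> * ln (S / m + 1)"
proof -
  have b0: "0 \<le> (\<Sum>t=2..T. b t)" using b by (intro sum_nonneg) auto
  have "(\<Sum>t=2..T. 16 / (\<mu> * real t) * b t) = 16 * m / \<mu> * (\<Sum>t=2..T. b t / m / real t)"
    unfolding sum_distrib_left using m by (intro sum.cong) (auto simp: field_simps)
  also have "\<dots> \<le> 16 * m / \<mu> * ln (1 + (\<Sum>t=2..T. b t / m))"
    using b m \<mu> by (intro mult_left_mono sum_divide_le_ln) auto
  also have "(\<Sum>t=2..T. b t / m) = (\<Sum>t=2..T. b t) / m" by (simp add: sum_divide_distrib)
  also have "16 * m / \<mu> * ln (1 + (\<Sum>t=2..T. b t) / m) \<le> 16 * m / \<mu> * ln (S / m + 1)"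
    using m \<mu> b0 S by (intro mult_left_mono ln_mono) (auto intro!: add_pos_nonneg divide_right_mono)
  finally show ?thesis .
qed

text \<open>With \<open>z = (A + B) / (a + b)\<close> the ratio on the left is at most
  \<open>2 * z\<close>, and \<open>1 + 2 * z \<le> (1 + z)\<^sup>2\<close>. The square leaves the
  logarithm as a factor 2, which turns 32 into 64.\<close>

lemma log_bound_weaken:
  fixes a b A B \<mu> :: real
  assumes "a \<ge> 0" "b \<ge> 0" "2 * a + b > 0" "A \<ge> 0" "B \<ge> 0" "\<mu> > 0"
  shows "(32 * a + 16 * b) / \<mu> * ln ((2 * A + B) / (2 * a + b) + 1)
    \<le> 64 / \<mu> * (a + b) * ln (1 + (A + B) / (a + b))"
proof -
  define z where "z = (A + B) / (a + b)"
  have ab: "a + b > 0" using assms by linarith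
  have z: "z \<ge> 0" using assms by (simp add: z_def)
  have "(2 * A + B) / (2 * a + b) \<le> (2 * (A + B)) / (a + b)"
    using assms ab by (intro frac_le) auto
  also have "\<dots> = 2 * z" by (simp add: z_def)
  finally have "(2 * A + B) / (2 * a + b) + 1 \<le> (1 + z)\<^sup>2"
    using zero_le_power2[of z] unfolding power2_sum one_power2 by linarith
  then have "ln ((2 * A + B) / (2 * a + b) + 1) \<le> ln ((1 + z)\<^sup>2)"
    using assms by (intro ln_mono) (auto intro!: add_nonneg_pos)
  also have "\<dots> = 2 * ln (1 + z)" using z by (simp add: ln_realpow)
  finally have "(32 * a + 16 * b) / \<mu> * ln ((2 * A + B) / (2 * a + b) + 1)
      \<le> (32 * (a + b)) / \<mu> * (2 * ln (1 + z))"
    using assms z by (intro mult_mono divide_right_mono) (auto intro!: ln_ge_zero divide_nonneg_pos)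
  also have "\<dots> = 64 / \<mu> * (a + b) * ln (1 + z)" by simp
  finally show ?thesis unfolding z_def .
qed

text \<open>The upper bounds \<open>U\<close> need not be measurable, hence the lower integral on the right.\<close>

lemma (in prob_space) sum_le_enn2real_nn_integral:
  fixes v U :: "'i \<Rightarrow> 'a \<Rightarrow> ennreal" and b :: "'i \<Rightarrow> real"
  assumes "finite I" "J \<subseteq> I" and v: "\<And>i. i \<in> J \<Longrightarrow> v i \<in> borel_measurable M"
    and vU: "\<And>i. i \<in> J \<Longrightarrow> AE w in M. v i w \<le> U i w"
    and U: "AE w in M. \<forall>i\<in>I. U i w \<le> ennreal B" and B: "B \<ge> 0"
    and b: "\<And>i. i \<in> J \<Longrightarrow> 0 \<le> b i" "\<And>i. i \<in> J \<Longrightarrow> ennreal (b i) \<le> (\<integral>\<^sup>+w. v i w \<partial>M)"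
  shows "sum b J \<le> enn2real (\<integral>\<^sup>+w. (\<Sum>i\<in>I. U i w) \<partial>M)" and "\<And>i. i \<in> J \<Longrightarrow> b i \<le> B"
proof -
  have J: "finite J" by (rule finite_subset[OF assms(2,1)])
  have vU': "AE w in M. \<forall>i\<in>J. v i w \<le> U i w" using vU J by (simp add: AE_ball_countable countable_finite)
  have "(\<integral>\<^sup>+w. (\<Sum>i\<in>I. U i w) \<partial>M) \<le> (\<integral>\<^sup>+w. ennreal (real (card I) * B) \<partial>M)"
  proof (rule nn_integral_mono_AE)
    show "AE w in M. (\<Sum>i\<in>I. U i w) \<le> ennreal (real (card I) * B)"
      using U
    proof eventually_elim
      case (elim w)
      have "(\<Sum>i\<in>I. U i w) \<le> (\<Sum>i\<in>I. ennreal B)" using elim by (intro sum_mono) auto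
      also have "\<dots> = ennreal (real (card I) * B)" using B by (simp add: ennreal_mult ennreal_of_nat_eq_real_of_nat)
      finally show ?case .
    qed
  qed
  also have "\<dots> < \<top>" by (simp add: emeasure_space_1)
  \<comment> \<open>Finiteness matters because \<open>enn2real\<close> sends infinity to 0 and is
    monotone only below \<open>\<top>\<close>.\<close>
  finally have fin: "(\<integral>\<^sup>+w. (\<Sum>i\<in>I. U i w) \<partial>M) < \<top>" .
  have "ennreal (sum b J) = (\<Sum>i\<in>J. ennreal (b i))" using b(1) by (simp add: sum_ennreal)
  also have "\<dots> \<le> (\<Sum>i\<in>J. \<integral>\<^sup>+w. v i w \<partial>M)" using b(2) by (intro sum_mono) auto
  also have "\<dots> = (\<integral>\<^sup>+w. (\<Sum>i\<in>J. v i w) \<partial>M)" using v by (intro nn_integral_sum[symmetric]) auto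
  also have "\<dots> \<le> (\<integral>\<^sup>+w. (\<Sum>i\<in>I. U i w) \<partial>M)"
  proof (rule nn_integral_mono_AE)
    show "AE w in M. (\<Sum>i\<in>J. v i w) \<le> (\<Sum>i\<in>I. U i w)"
      using vU'
    proof eventually_elim
      case (elim w)
      have "(\<Sum>i\<in>J. v i w) \<le> (\<Sum>i\<in>J. U i w)" using elim by (intro sum_mono) auto
      also have "\<dots> \<le> (\<Sum>i\<in>I. U i w)" using assms by (intro sum_mono2) auto
      finally show ?case .
    qed
  qed
  finally show "sum b J \<le> enn2real (\<integral>\<^sup>+w. (\<Sum>i\<in>I. U i w) \<partial>M)"
    using fin b(1) by (metis enn2real_ennreal enn2real_mono sum_nonneg)
  show "b i \<le> B" if i: "i \<in> J" for i
  proof -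
    have "ennreal (b i) \<le> (\<integral>\<^sup>+w. v i w \<partial>M)" by (rule b(2)[OF i])
    also have "\<dots> \<le> (\<integral>\<^sup>+w. ennreal B \<partial>M)"
    proof (rule nn_integral_mono_AE)
      show "AE w in M. v i w \<le> ennreal B" using vU[OF i] U
        by eventually_elim (use i assms(2) in \<open>auto intro: order_trans\<close>)
    qed
    also have "\<dots> = ennreal B" by (simp add: emeasure_space_1)
    finally show ?thesis using B by simp
  qed
qed

section \<open>Conditioning on the past within the model\<close>

context sea_model
begin

lemma kernel_measurable:
  assumes "t \<in> {1..T}"
  shows "Q t \<in> \<F> (t - 1) \<rightarrow>\<^sub>M subprob_algebra (loss_space X)"
  by (rule measurable_prob_algebraD[OF Q_measurable[OF assms]])

lemma loss_measurable:
  assumes "t \<in> {1..T}"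
  shows "f t \<in> M \<rightarrow>\<^sub>M loss_space X"
  by (rule measurable_from_subalg[OF subalg f_measurable[OF assms]])

lemma
  fixes h :: "'w \<Rightarrow> ('a \<Rightarrow> real) \<Rightarrow> real"
  assumes t: "t \<in> {1..T}"
    and h: "case_prod h \<in> borel_measurable (\<F> (t - 1) \<Otimes>\<^sub>M loss_space X)"
    and bound: "AE w in M. \<bar>h w (f t w)\<bar> \<le> B"
  shows integrable_loss: "integrable M (\<lambda>w. h w (f t w))"
    and integrable_loss_law: "integrable M (\<lambda>w. LINT \<phi>|Q t w. h w \<phi>)"
    and integral_loss_law: "(LINT w|M. h w (f t w)) = (LINT w|M. LINT \<phi>|Q t w. h w \<phi>)"
proof -
  have law: "AE w in M. real_cond_exp M (\<F> (t - 1)) (\<lambda>w. indicator A (f t w)) w = measure (Q t w) A"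
    if "A \<in> sets (loss_space X)" for A
    using f_conditional_law[OF t that] .
  note cl = integral_conditional_law[where M = M and F = "\<F> (t - 1)" and K = "Q t"
      and N = "loss_space X" and Y = "f t" and h = h and B = B,
      OF prob_space_axioms subalg Q_measurable[OF t] loss_measurable[OF t] law h bound]
  show "integrable M (\<lambda>w. h w (f t w))" by (rule cl(1))
  show "integrable M (\<lambda>w. LINT \<phi>|Q t w. h w \<phi>)" by (rule cl(2))
  show "(LINT w|M. h w (f t w)) = (LINT w|M. LINT \<phi>|Q t w. h w \<phi>)" by (rule cl(3))
qed

lemma nn_integral_loss_law:
  fixes h :: "'w \<Rightarrow> ('a \<Rightarrow> real) \<Rightarrow> ennreal"
  assumes t: "t \<in> {1..T}"
    and h: "case_prod h \<in> borel_measurable (\<F> (t - 1) \<Otimes>\<^sub>M loss_space X)"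
  shows "(\<integral>\<^sup>+w. h w (f t w) \<partial>M) = (\<integral>\<^sup>+w. (\<integral>\<^sup>+\<phi>. h w \<phi> \<partial>Q t w) \<partial>M)"
proof -
  have law: "AE w in M. real_cond_exp M (\<F> (t - 1)) (\<lambda>w. indicator A (f t w)) w = measure (Q t w) A"
    if "A \<in> sets (loss_space X)" for A
    using f_conditional_law[OF t that] .
  show ?thesis
    by (rule nn_integral_conditional_law[where M = M and F = "\<F> (t - 1)" and K = "Q t"
      and N = "loss_space X" and Y = "f t" and h = h,
      OF prob_space_axioms subalg Q_measurable[OF t] loss_measurable[OF t] law h])
qed

lemma filtration_measurable_mono:
  assumes "h \<in> \<F> s \<rightarrow>\<^sub>M N" "s \<le> t"
  shows "h \<in> \<F> t \<rightarrow>\<^sub>M N"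
proof (rule measurable_from_subalg[OF _ assms(1)])
  show "subalgebra (\<F> t) (\<F> s)"
    using sets_F_mono[OF assms(2)] by (auto simp: subalgebra_def space_F)
qed

lemma
  assumes y: "y \<in> borel_measurable (\<F> s)" and yX: "\<And>w. w \<in> space M \<Longrightarrow> y w \<in> X"
  shows pair_loss_measurable:
      "(\<lambda>(w, \<phi>). \<phi> (y w)) \<in> borel_measurable (\<F> s \<Otimes>\<^sub>M loss_space X)"
    and pair_gradient_measurable:
      "(\<lambda>(w, \<phi>). gradient \<phi> (y w)) \<in> borel_measurable (\<F> s \<Otimes>\<^sub>M loss_space X)"
proof -
  have "(\<lambda>z. y (fst z)) \<in> borel_measurable (\<F> s \<Otimes>\<^sub>M loss_space X)"
    by (rule measurable_compose[OF measurable_fst y])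
  moreover have "y (fst z) \<in> X" if "z \<in> space (\<F> s \<Otimes>\<^sub>M loss_space X)" for z
    using that by (intro yX) (auto simp: space_pair_measure space_F)
  ultimately show "(\<lambda>(w, \<phi>). \<phi> (y w)) \<in> borel_measurable (\<F> s \<Otimes>\<^sub>M loss_space X)"
    "(\<lambda>(w, \<phi>). gradient \<phi> (y w)) \<in> borel_measurable (\<F> s \<Otimes>\<^sub>M loss_space X)"
    using loss_apply_measurable[OF measurable_snd, of "\<lambda>z. y (fst z)" "\<F> s" X]
      gradient_apply_measurable[OF measurable_snd, of "\<lambda>z. y (fst z)" "\<F> s" X]
    by (simp_all add: case_prod_beta')
qed

text \<open>
  A version of \<open>w \<mapsto> gradient (expected_loss (Q t w)) (y w)\<close> that is measurable everywhere
  instead of almost everywhere.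
\<close>

definition mean_gradient :: "nat \<Rightarrow> ('w \<Rightarrow> 'a) \<Rightarrow> 'w \<Rightarrow> 'a" where
  "mean_gradient t y w = (LINT \<phi>|Q t w. gradient \<phi> (y w))"

lemma mean_gradient_measurable:
  assumes "t \<in> {1..T}" "y \<in> borel_measurable (\<F> (t - 1))" "\<And>w. w \<in> space M \<Longrightarrow> y w \<in> X"
  shows "mean_gradient t y \<in> borel_measurable (\<F> (t - 1))"
  unfolding mean_gradient_def[abs_def]
  using integral_kernel_measurable[OF kernel_measurable[OF assms(1)] pair_gradient_measurable[OF assms(2,3)]]
  by simp

text \<open>One exceptional set serves all points of \<open>X\<close> at once, which is what permits
  a random iterate to be substituted for \<open>z\<close>.\<close>

lemma AE_expected_loss_GDERIV:
  "AE w in M. \<forall>t\<in>{1..T}. \<forall>z\<in>X. integrable (Q t w) (\<lambda>\<phi>. \<phi> z) \<and>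
    integrable (Q t w) (\<lambda>\<phi>. gradient \<phi> z) \<and>
    GDERIV (expected_loss (Q t w)) z :> gradient (expected_loss (Q t w)) z \<and>
    (LINT \<phi>|Q t w. gradient \<phi> z) = gradient (expected_loss (Q t w)) z"
  using interchange by eventually_elim (metis gradient_eqI)

text \<open>Strong convexity is assumed of the mean loss only. The loss difference is therefore
  passed from the sample to its law, linearized there, and the linear term is passed back to the
  sampled gradient that the learner uses. Both passages rely on \<open>y\<close> being determined
  before the loss is drawn.\<close>

lemma expected_regret_le:
  assumes t: "t \<in> {1..T}" and y: "y \<in> borel_measurable (\<F> (t - 1))" "\<And>w. w \<in> space M \<Longrightarrow> y w \<in> X"
    and u: "u \<in> X" and diam: "\<And>z. z \<in> X \<Longrightarrow> norm (z - u) \<le> D"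
    and grad: "AE w in M. \<forall>z\<in>X. norm (gradient (f t w) z) \<le> G"
    and sc: "AE w in M. strongly_convex_on X \<mu> (expected_loss (Q t w))"
  shows "integrable M (\<lambda>w. f t w (y w) - f t w u)"
    and "integrable M (\<lambda>w. inner (gradient (f t w) (y w)) (y w - u) - \<mu> / 2 * (norm (y w - u))\<^sup>2)"
    and "(LINT w|M. f t w (y w) - f t w u)
      \<le> (LINT w|M. inner (gradient (f t w) (y w)) (y w - u) - \<mu> / 2 * (norm (y w - u))\<^sup>2)"
proof -
  have yM: "y \<in> borel_measurable M" by (rule measurable_from_subalg[OF subalg y(1)])
  have loss: "(\<lambda>(w, \<phi>). \<phi> (y w) - \<phi> u) \<in> borel_measurable (\<F> (t - 1) \<Otimes>\<^sub>M loss_space X)"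
  proof -
    have "(\<lambda>(w, \<phi>). \<phi> (y w)) \<in> borel_measurable (\<F> (t - 1) \<Otimes>\<^sub>M loss_space X)"
      by (rule pair_loss_measurable[OF y])
    moreover have "(\<lambda>(w, \<phi>). \<phi> u) \<in> borel_measurable (\<F> (t - 1) \<Otimes>\<^sub>M loss_space X)"
      by (rule pair_loss_measurable[of "\<lambda>_. u"]) (auto simp: u)
    ultimately show ?thesis unfolding case_prod_beta' by (rule borel_measurable_diff)
  qed
  have gr: "(\<lambda>(w, \<phi>). gradient \<phi> (y w)) \<in> borel_measurable (\<F> (t - 1) \<Otimes>\<^sub>M loss_space X)"
    by (rule pair_gradient_measurable[OF y])
  have lin: "(\<lambda>(w, \<phi>). inner (gradient \<phi> (y w)) (y w - u)) \<in> borel_measurable (\<F> (t - 1) \<Otimes>\<^sub>M loss_space X)"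
    using borel_measurable_inner[OF gr
        borel_measurable_diff[OF measurable_compose[OF measurable_fst y(1)] borel_measurable_const]]
    unfolding case_prod_beta' .
  \<comment> \<open>No sign of \<open>G\<close> is assumed here, hence the absolute value in the
    dominating constant.\<close>
  have lossB: "AE w in M. \<bar>f t w (y w) - f t w u\<bar> \<le> \<bar>G\<bar> * D"
    using grad AE_space
  proof eventually_elim
    case (elim w)
    have "\<bar>f t w (y w) - f t w u\<bar> \<le> G * norm (y w - u)"
      using measurable_space[OF loss_measurable[OF t] elim(2)] elim y(2) u
      by (intro GDERIV_bounded_lipschitz[OF X_convex]) (auto simp: space_loss_space)
    also have "\<dots> \<le> \<bar>G\<bar> * D" using diam[OF y(2)[OF elim(2)]] by (intro mult_mono) auto
    finally show ?case .
  qed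
  have linB: "AE w in M. \<bar>inner (gradient (f t w) (y w)) (y w - u)\<bar> \<le> \<bar>G\<bar> * D"
    using grad AE_space
  proof eventually_elim
    case (elim w)
    have "\<bar>inner (gradient (f t w) (y w)) (y w - u)\<bar> \<le> norm (gradient (f t w) (y w)) * norm (y w - u)"
      by (rule Cauchy_Schwarz_ineq2)
    also have "\<dots> \<le> \<bar>G\<bar> * D" using elim y(2) diam
      by (intro mult_mono) (auto intro: order_trans[OF _ abs_ge_self])
    finally show ?case .
  qed
  note I2 = integrable_loss[OF t, of "\<lambda>w \<phi>. inner (gradient \<phi> (y w)) (y w - u)", OF lin linB]
      integrable_loss_law[OF t, of "\<lambda>w \<phi>. inner (gradient \<phi> (y w)) (y w - u)", OF lin linB]
      integral_loss_law[OF t, of "\<lambda>w \<phi>. inner (gradient \<phi> (y w)) (y w - u)", OF lin linB]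
  show "integrable M (\<lambda>w. f t w (y w) - f t w u)"
    by (rule integrable_loss[OF t, of "\<lambda>w \<phi>. \<phi> (y w) - \<phi> u", OF loss lossB])
  have sq: "integrable M (\<lambda>w. \<mu> / 2 * (norm (y w - u))\<^sup>2)"
  proof (rule integrable_mult_right, rule integrable_const_bound[of _ "D\<^sup>2"])
    show "AE w in M. norm ((norm (y w - u))\<^sup>2) \<le> D\<^sup>2"
      using AE_space by eventually_elim (use diam y(2) in \<open>auto intro!: power_mono\<close>)
  qed (use yM in measurable)
  show "integrable M (\<lambda>w. inner (gradient (f t w) (y w)) (y w - u) - \<mu> / 2 * (norm (y w - u))\<^sup>2)"
    by (rule Bochner_Integration.integrable_diff[OF I2(1) sq])
  have "(LINT w|M. f t w (y w) - f t w u) = (LINT w|M. LINT \<phi>|Q t w. \<phi> (y w) - \<phi> u)"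
    by (rule integral_loss_law[OF t, of "\<lambda>w \<phi>. \<phi> (y w) - \<phi> u", OF loss lossB])
  also have "\<dots> \<le> (LINT w|M. (LINT \<phi>|Q t w. inner (gradient \<phi> (y w)) (y w - u)) - \<mu> / 2 * (norm (y w - u))\<^sup>2)"
  proof (rule integral_mono_AE)
    show "integrable M (\<lambda>w. LINT \<phi>|Q t w. \<phi> (y w) - \<phi> u)" by (rule integrable_loss_law[OF t, of "\<lambda>w \<phi>. \<phi> (y w) - \<phi> u", OF loss lossB])
    show "integrable M (\<lambda>w. (LINT \<phi>|Q t w. inner (gradient \<phi> (y w)) (y w - u)) - \<mu> / 2 * (norm (y w - u))\<^sup>2)"
      by (rule Bochner_Integration.integrable_diff[OF I2(2) sq])
    show "AE w in M. (LINT \<phi>|Q t w. \<phi> (y w) - \<phi> u)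
        \<le> (LINT \<phi>|Q t w. inner (gradient \<phi> (y w)) (y w - u)) - \<mu> / 2 * (norm (y w - u))\<^sup>2"
      using AE_expected_loss_GDERIV sc AE_space
    proof eventually_elim
      case (elim w)
      note w = elim(1)[rule_format, OF t]
      have yw: "y w \<in> X" using y(2) elim by simp
      have "(LINT \<phi>|Q t w. \<phi> (y w) - \<phi> u) = expected_loss (Q t w) (y w) - expected_loss (Q t w) u"
        using w[OF yw] w[OF u] by (simp add: expected_loss_def)
      also have "\<dots> \<le> inner (gradient (expected_loss (Q t w)) (y w)) (y w - u) - \<mu> / 2 * (norm (y w - u))\<^sup>2"
        using w[OF yw] by (intro strongly_convex_on_first_order[OF elim(2) _ yw u]) auto
      also have "inner (gradient (expected_loss (Q t w)) (y w)) (y w - u)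
          = (LINT \<phi>|Q t w. inner (gradient \<phi> (y w)) (y w - u))"
        using w[OF yw] by simp
      finally show ?case .
    qed
  qed
  also have "\<dots> = (LINT w|M. inner (gradient (f t w) (y w)) (y w - u) - \<mu> / 2 * (norm (y w - u))\<^sup>2)"
    using I2 sq by simp
  finally show "(LINT w|M. f t w (y w) - f t w u)
      \<le> (LINT w|M. inner (gradient (f t w) (y w)) (y w - u) - \<mu> / 2 * (norm (y w - u))\<^sup>2)" .
qed

text \<open>The conditional second moment of the noise at a single point determined by the past. It
  is a measurable intermediary between the squared noise of the sample and
  \<open>loss_variance\<close>, a supremum that may fail to be measurable.\<close>

definition realized_variance :: "nat \<Rightarrow> ('w \<Rightarrow> 'a) \<Rightarrow> 'w \<Rightarrow> ennreal" where
  "realized_variance t y w =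
     (\<integral>\<^sup>+ \<phi>. ennreal ((norm (gradient \<phi> (y w) - mean_gradient t y w))\<^sup>2) \<partial>Q t w)"

lemma
  assumes t: "t \<in> {1..T}" and y: "y \<in> borel_measurable (\<F> (t - 1))" "\<And>w. w \<in> space M \<Longrightarrow> y w \<in> X"
  shows realized_variance_measurable: "realized_variance t y \<in> borel_measurable M"
    and nn_integral_realized_variance:
      "(\<integral>\<^sup>+w. ennreal ((norm (gradient (f t w) (y w) - mean_gradient t y w))\<^sup>2) \<partial>M)
        = (\<integral>\<^sup>+w. realized_variance t y w \<partial>M)"
    and AE_realized_variance_le: "AE w in M. realized_variance t y w \<le> loss_variance X (Q t w)"
proof -
  have h: "(\<lambda>(w, \<phi>). ennreal ((norm (gradient \<phi> (y w) - mean_gradient t y w))\<^sup>2))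
      \<in> borel_measurable (\<F> (t - 1) \<Otimes>\<^sub>M loss_space X)"
  proof -
    have "(\<lambda>(w, \<phi>). gradient \<phi> (y w)) \<in> borel_measurable (\<F> (t - 1) \<Otimes>\<^sub>M loss_space X)"
      by (rule pair_gradient_measurable[OF y])
    moreover have "mean_gradient t y \<in> borel_measurable (\<F> (t - 1))"
      by (rule mean_gradient_measurable[OF t y])
    then have "(\<lambda>z. mean_gradient t y (fst z)) \<in> borel_measurable (\<F> (t - 1) \<Otimes>\<^sub>M loss_space X)"
      by (rule measurable_compose[OF measurable_fst])
    ultimately show ?thesis
      unfolding case_prod_beta'
      by (intro measurable_compose[OF _ measurable_ennreal] borel_measurable_power
          measurable_compose[OF _ borel_measurable_norm] borel_measurable_diff)
  qed
  show "realized_variance t y \<in> borel_measurable M"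
    unfolding realized_variance_def[abs_def]
    by (rule measurable_from_subalg[OF subalg nn_integral_measurable_subprob_algebra2[OF h kernel_measurable[OF t]]])
  show "(\<integral>\<^sup>+w. ennreal ((norm (gradient (f t w) (y w) - mean_gradient t y w))\<^sup>2) \<partial>M)
        = (\<integral>\<^sup>+w. realized_variance t y w \<partial>M)"
    unfolding realized_variance_def
    by (rule nn_integral_loss_law[OF t,
          of "\<lambda>w \<phi>. ennreal ((norm (gradient \<phi> (y w) - mean_gradient t y w))\<^sup>2)", OF h])
  show "AE w in M. realized_variance t y w \<le> loss_variance X (Q t w)"
    using AE_expected_loss_GDERIV AE_space
  proof eventually_elim
    case (elim w)
    have yw: "y w \<in> X" using y(2) elim by simp
    then have "mean_gradient t y w = gradient (expected_loss (Q t w)) (y w)"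
      using elim t by (simp add: mean_gradient_def)
    then show ?case unfolding realized_variance_def loss_variance_def using yw
      by (auto intro!: SUP_upper2[of "y w"])
  qed
qed

text \<open>Rounds start at 2 because \<open>expected_gradient\<close> is 0 by convention at index
  0, whereas \<open>mean_gradient\<close> would refer to \<open>Q 0\<close>, which the model does
  not constrain.\<close>

lemma AE_mean_gradient_drift_le:
  assumes t: "t \<in> {2..T}" and yX: "\<And>w. w \<in> space M \<Longrightarrow> y w \<in> X"
  shows "AE w in M. ennreal ((norm (mean_gradient t y w - mean_gradient (t - 1) y w))\<^sup>2)
    \<le> gradient_drift X Q t w"
  using AE_expected_loss_GDERIV AE_space
proof eventually_elim
  case (elim w)
  have yw: "y w \<in> X" using yX elim by simp
  have "t \<in> {1..T}" "t - 1 \<in> {1..T}" using t by auto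
  then have "mean_gradient t y w = gradient (expected_loss (Q t w)) (y w)"
      "mean_gradient (t - 1) y w = gradient (expected_loss (Q (t - 1) w)) (y w)"
    using elim yw by (auto simp: mean_gradient_def)
  then show ?case using t unfolding gradient_drift_def expected_gradient_def
    by (auto intro!: SUP_upper2[OF yw])
qed

end

theorem theorem3:
  fixes M :: "'w measure" and \<F> :: "nat \<Rightarrow> 'w measure"
    and X :: "'a::euclidean_space set" and T :: nat
    and f :: "nat \<Rightarrow> 'w \<Rightarrow> 'a \<Rightarrow> real"
    and Q :: "nat \<Rightarrow> 'w \<Rightarrow> ('a \<Rightarrow> real) measure"
    and x xhat :: "nat \<Rightarrow> 'w \<Rightarrow> 'a" and x1 u :: 'a
    and G D L \<mu> \<sigma>2max \<Sigma>2max :: real and \<eta> :: "nat \<Rightarrow> real"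
  assumes model: "sea_model M \<F> X T f Q"
    and constants: "G > 0" "D > 0" "L > 0" "\<mu> > 0"
      "\<sigma>2max \<ge> 0" "\<Sigma>2max \<ge> 0" "2 * \<sigma>2max + \<Sigma>2max > 0"
    and gradient_bound: "AE w in M. \<forall>t\<in>{1..T}. \<forall>y\<in>X. norm (gradient (f t w) y) \<le> G"
    and domain: "0 \<in> X" "\<forall>y\<in>X. \<forall>z\<in>X. norm (y - z) \<le> D"
    and variance_bound: "AE w in M. \<forall>t\<in>{1..T}. loss_variance X (Q t w) \<le> ennreal \<sigma>2max"
    and drift_bound: "AE w in M. \<forall>t\<in>{1..T}. gradient_drift X Q t w \<le> ennreal \<Sigma>2max"
    and smooth: "AE w in M. \<forall>t\<in>{1..T}. \<forall>y\<in>X. \<forall>z\<in>X.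
      norm (gradient (expected_loss (Q t w)) y - gradient (expected_loss (Q t w)) z) \<le> L * norm (y - z)"
    and strongly_convex: "AE w in M. \<forall>t\<in>{1..T}. strongly_convex_on X \<mu> (expected_loss (Q t w))"
    and step_size: "\<forall>t. \<eta> t = 2 / (\<mu> * real t)"
    and init: "x1 \<in> X" "\<forall>w\<in>space M. x 1 w = x1 \<and> xhat 1 w = x1"
    and update: "\<forall>t\<in>{1..<T}. \<forall>w\<in>space M.
      xhat (t + 1) w = closest_point X (xhat t w - \<eta> t *\<^sub>R gradient (f t w) (x t w)) \<and>
      x (t + 1) w = closest_point X (xhat (t + 1) w - \<eta> (t + 1) *\<^sub>R gradient (f t w) (x t w))"
    and comparator: "u \<in> X"
  shows "(LINT w|M. (\<Sum>t=1..T. f t w (x t w)) - (\<Sum>t=1..T. f t w u))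
      \<le> (32 * \<sigma>2max + 16 * \<Sigma>2max) / \<mu>
          * ln ((2 * cumulative_variance M X T Q + cumulative_drift M X T Q) / (2 * \<sigma>2max + \<Sigma>2max) + 1)
        + (64 * \<sigma>2max + 32 * \<Sigma>2max) / \<mu>
        + 16 * L\<^sup>2 * D\<^sup>2 / \<mu> * ln (1 + 8 * sqrt 2 * (L / \<mu>))
        + (16 * L\<^sup>2 * D\<^sup>2 + 4 * G\<^sup>2) / \<mu>
        + \<mu> * D\<^sup>2 / 4
    \<and> (LINT w|M. (\<Sum>t=1..T. f t w (x t w)) - (\<Sum>t=1..T. f t w u))
      \<le> 64 / \<mu> * (\<sigma>2max + \<Sigma>2max)
          * ln (1 + (cumulative_variance M X T Q + cumulative_drift M X T Q) / (\<sigma>2max + \<Sigma>2max))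
        + regret_offset D G L \<mu> \<sigma>2max \<Sigma>2max"
proof -
  interpret sea_model M \<F> X T f Q by (rule model)
  note \<mu> = constants(4)
  have diam: "norm (y - z) \<le> D" if "y \<in> X" "z \<in> X" for y z using domain(2) that by blast
  have proj: "closest_point X \<in> borel_measurable borel"
    by (intro borel_measurable_continuous_onI continuous_on_closest_point X_convex X_closed X_nonempty)
  \<comment> \<open>Predictability: the iterate of round \<open>Suc n\<close> uses losses up to
    round \<open>n\<close> only. The induction also carries \<open>xhat\<close>, through which the
    past enters the update, and membership in \<open>X\<close>, without which the gradient at the
    iterate need not be measurable.\<close>
  have iterates: "x (Suc n) \<in> borel_measurable (\<F> n) \<and> xhat (Suc n) \<in> borel_measurable (\<F> n) \<and>
      (\<forall>w\<in>space M. x (Suc n) w \<in> X)" if "Suc n \<le> T" for n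
    using that
  proof (induction n)
    case 0
    have "x (Suc 0) \<in> borel_measurable (\<F> 0) \<longleftrightarrow> (\<lambda>_. x1) \<in> borel_measurable (\<F> 0)"
      "xhat (Suc 0) \<in> borel_measurable (\<F> 0) \<longleftrightarrow> (\<lambda>_. x1) \<in> borel_measurable (\<F> 0)"
      using init(2) by (intro measurable_cong; simp add: space_F)+
    then show ?case using init by simp
  next
    case (Suc n)
    then have IH: "x (Suc n) \<in> borel_measurable (\<F> n)" "xhat (Suc n) \<in> borel_measurable (\<F> n)"
      "\<And>w. w \<in> space M \<Longrightarrow> x (Suc n) w \<in> X" by auto
    have n: "Suc n \<in> {1..<T}" "Suc n \<in> {1..T}" using Suc.prems by auto
    let ?g = "\<lambda>w. gradient (f (Suc n) w) (x (Suc n) w)"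
    have g: "?g \<in> borel_measurable (\<F> (Suc n))"
    proof (rule gradient_apply_measurable[OF f_measurable[OF n(2)]])
      show "x (Suc n) \<in> borel_measurable (\<F> (Suc n))"
        by (rule filtration_measurable_mono[OF IH(1)]) simp
    qed (use IH(3) in \<open>simp add: space_F\<close>)
    have step: "(\<lambda>w. closest_point X (h w - c *\<^sub>R ?g w)) \<in> borel_measurable (\<F> (Suc n))"
      if "h \<in> borel_measurable (\<F> (Suc n))" for h c
      by (intro measurable_compose[OF _ proj] borel_measurable_diff that borel_measurable_scaleR
          borel_measurable_const g)
    have "xhat (Suc (Suc n)) \<in> borel_measurable (\<F> (Suc n)) \<longleftrightarrow>
        (\<lambda>w. closest_point X (xhat (Suc n) w - \<eta> (Suc n) *\<^sub>R ?g w)) \<in> borel_measurable (\<F> (Suc n))"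
      using update n by (intro measurable_cong) (simp add: space_F)
    then have xh: "xhat (Suc (Suc n)) \<in> borel_measurable (\<F> (Suc n))"
      using step[OF filtration_measurable_mono[OF IH(2)], of "\<eta> (Suc n)"] by simp
    have "x (Suc (Suc n)) \<in> borel_measurable (\<F> (Suc n)) \<longleftrightarrow>
        (\<lambda>w. closest_point X (xhat (Suc (Suc n)) w - \<eta> (Suc (Suc n)) *\<^sub>R ?g w)) \<in> borel_measurable (\<F> (Suc n))"
      using update n by (intro measurable_cong) (simp add: space_F)
    then have "x (Suc (Suc n)) \<in> borel_measurable (\<F> (Suc n))" using step[OF xh] by simp
    moreover have "x (Suc (Suc n)) w \<in> X" if "w \<in> space M" for w
      using update n that closest_point_in_set[OF X_closed X_nonempty] by simp
    ultimately show ?case using xh by simp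
  qed
  have xF: "x t \<in> borel_measurable (\<F> (t - 1))" if "t \<in> {1..T}" for t
    using iterates[of "t - 1"] that by simp
  have xX: "x t w \<in> X" if "t \<in> {1..T}" "w \<in> space M" for t w
    using iterates[of "t - 1"] that by simp
  \<comment> \<open>The drift of round \<open>t\<close> compares two mean gradients at the previous
    iterate, so that iterate must be known to the later kernel as well.\<close>
  have xF': "x (t - 1) \<in> borel_measurable (\<F> (t - 1))" if "t \<in> {2..T}" for t
    using that by (intro filtration_measurable_mono[OF xF]) auto

  \<comment> \<open>Pathwise bound along almost every outcome\<close>
  define g where "g t w = gradient (f t w) (x t w)" for t w
  define \<psi> where "\<psi> t w = inner (g t w) (x t w - u) - \<mu> / 2 * (norm (x t w - u))\<^sup>2" for t w
  define e where "e t w = (norm (g t w - mean_gradient t (x t) w))\<^sup>2" for t w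
  define d where "d t w = (norm (mean_gradient t (x (t - 1)) w - mean_gradient (t - 1) (x (t - 1)) w))\<^sup>2" for t w
  define C where "C = \<mu> * D\<^sup>2 / 4 + 4 * G\<^sup>2 / \<mu> + 16 * L\<^sup>2 * D\<^sup>2 / \<mu> * ln (1 + 8 * sqrt 2 * (L / \<mu>))"

  have pathwise: "AE w in M. (\<Sum>t=1..T. \<psi> t w)
      \<le> C + (\<Sum>t=2..T. 16 / (\<mu> * real t) * (e t w + d t w + e (t - 1) w))"
    using AE_expected_loss_GDERIV gradient_bound smooth AE_space
  proof eventually_elim
    case (elim w)
    let ?p = "\<lambda>t. gradient (expected_loss (Q t w))"
    \<comment> \<open>Interchanging gradient and expectation identifies the measurable integral with
      the gradient of the expected loss, for which smoothness is assumed.\<close>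
    have mg: "mean_gradient t y w = ?p t (y w)" if "t \<in> {1..T}" "y w \<in> X" for t y
      using elim(1) that by (simp add: mean_gradient_def)
    have "(\<Sum>t=1..T. \<psi> t w) \<le> C + (\<Sum>t=2..T. 16 / (\<mu> * real t) * ((norm (g t w - ?p t (x t w)))\<^sup>2
          + (norm (?p t (x (t - 1) w) - ?p (t - 1) (x (t - 1) w)))\<^sup>2
          + (norm (g (t - 1) w - ?p (t - 1) (x (t - 1) w)))\<^sup>2))"
      unfolding C_def \<psi>_def
    proof (rule pathwise_regret_bound[where \<eta> = \<eta> and xh = "\<lambda>t. xhat t w", OF X_convex X_closed comparator diam \<mu> constants(3) T_pos])
      show "norm (g 1 w) \<le> G" using elim(2) T_pos xX[of 1 w] elim(4) by (simp add: g_def)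
      show "norm (?p (t + 1) (x (t + 1) w) - ?p (t + 1) (x t w)) \<le> L * norm (x (t + 1) w - x t w)"
        if "t \<in> {1..<T}" for t using elim(3) that xX elim(4) by auto
    qed (use step_size init update elim(4) in \<open>auto simp: g_def\<close>)
    also have "(\<Sum>t=2..T. 16 / (\<mu> * real t) * ((norm (g t w - ?p t (x t w)))\<^sup>2
          + (norm (?p t (x (t - 1) w) - ?p (t - 1) (x (t - 1) w)))\<^sup>2
          + (norm (g (t - 1) w - ?p (t - 1) (x (t - 1) w)))\<^sup>2))
        = (\<Sum>t=2..T. 16 / (\<mu> * real t) * (e t w + d t w + e (t - 1) w))"
    proof (rule sum.cong[OF refl])
      fix t assume "t \<in> {2..T}"
      then have "t \<in> {1..T}" "t - 1 \<in> {1..T}" by auto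
      then show "16 / (\<mu> * real t) * ((norm (g t w - ?p t (x t w)))\<^sup>2
          + (norm (?p t (x (t - 1) w) - ?p (t - 1) (x (t - 1) w)))\<^sup>2
          + (norm (g (t - 1) w - ?p (t - 1) (x (t - 1) w)))\<^sup>2)
          = 16 / (\<mu> * real t) * (e t w + d t w + e (t - 1) w)"
        using xX elim(4) by (simp add: e_def d_def mg)
    qed
    finally show ?case .
  qed

  \<comment> \<open>Measurability and integrability of noise and drift\<close>
  have gM: "g t \<in> borel_measurable M" if t: "t \<in> {1..T}" for t
    unfolding g_def[abs_def] using xX[OF t]
    by (intro gradient_apply_measurable[OF loss_measurable[OF t] measurable_from_subalg[OF subalg xF[OF t]]])
  have e_nn: "(\<integral>\<^sup>+w. ennreal (e t w) \<partial>M) = (\<integral>\<^sup>+w. realized_variance t (x t) w \<partial>M)" if t: "t \<in> {1..T}" for t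
    unfolding e_def g_def by (rule nn_integral_realized_variance[OF t xF[OF t] xX[OF t]])
  have e_var: "AE w in M. realized_variance t (x t) w \<le> loss_variance X (Q t w)" if t: "t \<in> {1..T}" for t
    by (rule AE_realized_variance_le[OF t xF[OF t] xX[OF t]])
  \<comment> \<open>The variance bound controls \<open>e t\<close> only in conditional mean, so
    integrability is read off from the integral; \<open>d t\<close> below is bounded almost
    surely.\<close>
  have e_int: "integrable M (e t)" if t: "t \<in> {1..T}" for t
  proof (rule integrableI_nonneg)
    have "mean_gradient t (x t) \<in> borel_measurable M"
      by (rule measurable_from_subalg[OF subalg mean_gradient_measurable[OF t xF[OF t] xX[OF t]]])
    then show "e t \<in> borel_measurable M" unfolding e_def[abs_def] using gM[OF t] by simp
    have "(\<integral>\<^sup>+w. ennreal (e t w) \<partial>M) \<le> (\<integral>\<^sup>+w. ennreal \<sigma>2max \<partial>M)"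
      unfolding e_nn[OF t]
    proof (rule nn_integral_mono_AE)
      show "AE w in M. realized_variance t (x t) w \<le> ennreal \<sigma>2max"
        using e_var[OF t] variance_bound by eventually_elim (use t in \<open>auto intro: order_trans\<close>)
    qed
    also have "\<dots> < \<infinity>" by (simp add: emeasure_space_1)
    finally show "(\<integral>\<^sup>+w. ennreal (e t w) \<partial>M) < \<infinity>" .
  qed (auto simp: e_def)
  have d_drift: "AE w in M. ennreal (d t w) \<le> gradient_drift X Q t w" if t: "t \<in> {2..T}" for t
    unfolding d_def using t by (intro AE_mean_gradient_drift_le xX) auto
  have d_meas: "d t \<in> borel_measurable M" if t: "t \<in> {2..T}" for t
  proof -
    have t': "t \<in> {1..T}" "t - 1 \<in> {1..T}" using t by auto
    have "mean_gradient t (x (t - 1)) \<in> borel_measurable M"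
      by (rule measurable_from_subalg[OF subalg mean_gradient_measurable[OF t'(1) xF'[OF t] xX[OF t'(2)]]])
    moreover have "mean_gradient (t - 1) (x (t - 1)) \<in> borel_measurable M"
      by (rule measurable_from_subalg[OF subalg mean_gradient_measurable[OF t'(2) xF[OF t'(2)] xX[OF t'(2)]]])
    ultimately show ?thesis unfolding d_def[abs_def] by simp
  qed
  have d_int: "integrable M (d t)" if t: "t \<in> {2..T}" for t
  proof (rule integrable_const_bound[OF _ d_meas[OF t]])
    show "AE w in M. norm (d t w) \<le> \<Sigma>2max"
      using d_drift[OF t] drift_bound
    proof eventually_elim
      case (elim w)
      have "ennreal (d t w) \<le> ennreal \<Sigma>2max" using elim t by (auto intro: order_trans)
      then show ?case using constants(6) by (simp add: d_def)
    qed
  qed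

  \<comment> \<open>Expected noise and drift against the cumulative quantities\<close>
  define a where "a t = (LINT w|M. e t w)" for t
  define b where "b t = (LINT w|M. d t w)" for t
  have a0: "0 \<le> a t" for t unfolding a_def by (rule Bochner_Integration.integral_nonneg) (simp add: e_def)
  have b0: "0 \<le> b t" for t unfolding b_def by (rule Bochner_Integration.integral_nonneg) (simp add: d_def)
  have a: "sum a {1..T} \<le> cumulative_variance M X T Q" "\<And>t. t \<in> {1..T} \<Longrightarrow> a t \<le> \<sigma>2max"
  proof -
    have an: "ennreal (a t) \<le> (\<integral>\<^sup>+w. realized_variance t (x t) w \<partial>M)" if t: "t \<in> {1..T}" for t
      unfolding e_nn[OF t, symmetric] a_def
      by (subst nn_integral_eq_integral[OF e_int[OF t]]) (auto simp: e_def)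
    note S = sum_le_enn2real_nn_integral[of "{1..T}" "{1..T}" "\<lambda>t. realized_variance t (x t)"
        "\<lambda>t w. loss_variance X (Q t w)" \<sigma>2max a, OF finite_atLeastAtMost order_refl
        realized_variance_measurable e_var variance_bound constants(5) a0 an]
    show "sum a {1..T} \<le> cumulative_variance M X T Q"
      unfolding cumulative_variance_def by (rule S(1)) (use xF xX in auto)
    show "a t \<le> \<sigma>2max" if "t \<in> {1..T}" for t
      by (rule S(2)) (use xF xX that in auto)
  qed
  have b: "sum b {2..T} \<le> cumulative_drift M X T Q" "\<And>t. t \<in> {2..T} \<Longrightarrow> b t \<le> \<Sigma>2max"
  proof -
    have bn: "ennreal (b t) \<le> (\<integral>\<^sup>+w. ennreal (d t w) \<partial>M)" if t: "t \<in> {2..T}" for t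
      unfolding b_def by (subst nn_integral_eq_integral[OF d_int[OF t]]) (auto simp: d_def)
    have dm: "(\<lambda>w. ennreal (d t w)) \<in> borel_measurable M" if t: "t \<in> {2..T}" for t
      using d_meas[OF t] by simp
    \<comment> \<open>The cumulative drift also contains round 1, where the gradient is compared
      with 0; that summand is nonnegative, so restricting to \<open>{2..T}\<close> only lowers the
      sum.\<close>
    have sub: "{2..T} \<subseteq> {1..T}" by auto
    note S = sum_le_enn2real_nn_integral[of "{1..T}" "{2..T}" "\<lambda>t w. ennreal (d t w)"
        "\<lambda>t w. gradient_drift X Q t w" \<Sigma>2max b, OF finite_atLeastAtMost sub
        dm d_drift drift_bound constants(6) b0 bn]
    show "sum b {2..T} \<le> cumulative_drift M X T Q"
      unfolding cumulative_drift_def by (rule S(1))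
    show "b t \<le> \<Sigma>2max" if "t \<in> {2..T}" for t by (rule S(2)) (use that in auto)
  qed

  define V where "V = cumulative_variance M X T Q"
  define W where "W = cumulative_drift M X T Q"
  have VW: "V \<ge> 0" "W \<ge> 0" by (simp_all add: V_def W_def cumulative_variance_def cumulative_drift_def)
  \<comment> \<open>The noise of one round enters the gradient variation of that round and of the
    next, which is the origin of the factor 2 in \<open>2 * V + W\<close> and in the per-round bound
    \<open>2 * \<sigma>2max + \<Sigma>2max\<close>.\<close>
  have noise: "(\<Sum>t=2..T. 16 / (\<mu> * real t) * (a t + b t + a (t - 1)))
      \<le> 16 * (2 * \<sigma>2max + \<Sigma>2max) / \<mu> * ln ((2 * V + W) / (2 * \<sigma>2max + \<Sigma>2max) + 1)"
  proof (rule noise_sum_le_ln[OF constants(7) \<mu>])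
    show "0 \<le> a t + b t + a (t - 1) \<and> a t + b t + a (t - 1) \<le> 2 * \<sigma>2max + \<Sigma>2max" if t: "t \<in> {2..T}" for t
    proof -
      have "a t \<le> \<sigma>2max" "a (t - 1) \<le> \<sigma>2max" by (rule a(2), use t in auto)+
      then show ?thesis using b(2)[OF t] a0[of t] a0[of "t - 1"] b0[of t] by linarith
    qed
    have "(\<Sum>t=2..T. a t) \<le> sum a {1..T}" using a0 by (intro sum_mono2) auto
    moreover have "(\<Sum>t=2..T. a (t - 1)) = sum a ((\<lambda>t. t - 1) ` {2..T})"
      by (subst sum.reindex) (auto simp: inj_on_def)
    moreover have "\<dots> \<le> sum a {1..T}" using a0 by (intro sum_mono2) auto
    ultimately show "(\<Sum>t=2..T. a t + b t + a (t - 1)) \<le> 2 * V + W"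
      using a(1) b(1) unfolding V_def W_def sum.distrib by linarith
  qed

  \<comment> \<open>Expected regret and the final constants\<close>
  have round_bound: "integrable M (\<lambda>w. f t w (x t w) - f t w u)" "integrable M (\<psi> t)"
    "(LINT w|M. f t w (x t w) - f t w u) \<le> (LINT w|M. \<psi> t w)" if t: "t \<in> {1..T}" for t
  proof -
    have G: "AE w in M. \<forall>z\<in>X. norm (gradient (f t w) z) \<le> G"
      using gradient_bound by eventually_elim (use t in auto)
    have sc: "AE w in M. strongly_convex_on X \<mu> (expected_loss (Q t w))"
      using strongly_convex by eventually_elim (use t in auto)
    note R = expected_regret_le[OF t xF[OF t] xX[OF t] comparator diam[OF _ comparator] G sc]
    show "integrable M (\<lambda>w. f t w (x t w) - f t w u)" by (rule R(1))
    show "integrable M (\<psi> t)" unfolding \<psi>_def[abs_def] g_def by (rule R(2))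
    show "(LINT w|M. f t w (x t w) - f t w u) \<le> (LINT w|M. \<psi> t w)"
      unfolding \<psi>_def g_def by (rule R(3))
  qed
  have noise_int: "integrable M (\<lambda>w. 16 / (\<mu> * real t) * (e t w + d t w + e (t - 1) w))"
    if t: "t \<in> {2..T}" for t
    using t by (intro integrable_mult_right Bochner_Integration.integrable_add e_int d_int) auto
  have "(LINT w|M. (\<Sum>t=1..T. f t w (x t w)) - (\<Sum>t=1..T. f t w u))
      = (LINT w|M. (\<Sum>t=1..T. f t w (x t w) - f t w u))"
    by (simp add: sum_subtractf)
  also have "\<dots> = (\<Sum>t=1..T. (LINT w|M. f t w (x t w) - f t w u))"
    by (rule Bochner_Integration.integral_sum) (rule round_bound(1))
  also have "\<dots> \<le> (\<Sum>t=1..T. (LINT w|M. \<psi> t w))" by (intro sum_mono round_bound(3))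
  also have "\<dots> = (LINT w|M. (\<Sum>t=1..T. \<psi> t w))"
    by (rule Bochner_Integration.integral_sum[symmetric]) (rule round_bound(2))
  also have "\<dots> \<le> (LINT w|M. C + (\<Sum>t=2..T. 16 / (\<mu> * real t) * (e t w + d t w + e (t - 1) w)))"
    using pathwise round_bound(2) noise_int
    by (intro integral_mono_AE Bochner_Integration.integrable_add Bochner_Integration.integrable_sum) auto
  also have "\<dots> = C + (\<Sum>t=2..T. (LINT w|M. 16 / (\<mu> * real t) * (e t w + d t w + e (t - 1) w)))"
  proof -
    have "integrable M (\<lambda>w. \<Sum>t=2..T. 16 / (\<mu> * real t) * (e t w + d t w + e (t - 1) w))"
      by (rule Bochner_Integration.integrable_sum) (rule noise_int)
    note add = Bochner_Integration.integral_add[OF integrable_const[of C] this]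
    show ?thesis
      unfolding add by (subst Bochner_Integration.integral_sum) (simp_all only: noise_int lebesgue_integral_const prob_space scaleR_one)
  qed
  also have "(\<Sum>t=2..T. (LINT w|M. 16 / (\<mu> * real t) * (e t w + d t w + e (t - 1) w)))
      = (\<Sum>t=2..T. 16 / (\<mu> * real t) * (a t + b t + a (t - 1)))"
  proof (rule sum.cong[OF refl])
    fix t assume t: "t \<in> {2..T}"
    have "integrable M (e t)" "integrable M (d t)" "integrable M (e (t - 1))"
      using t by (intro e_int d_int; auto)+
    then show "(LINT w|M. 16 / (\<mu> * real t) * (e t w + d t w + e (t - 1) w))
        = 16 / (\<mu> * real t) * (a t + b t + a (t - 1))"
      by (simp add: a_def b_def)
  qed
  finally have regret: "(LINT w|M. (\<Sum>t=1..T. f t w (x t w)) - (\<Sum>t=1..T. f t w u))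
      \<le> C + 16 * (2 * \<sigma>2max + \<Sigma>2max) / \<mu> * ln ((2 * V + W) / (2 * \<sigma>2max + \<Sigma>2max) + 1)"
    using noise by linarith
  \<comment> \<open>The sums from round 2 on were bounded by logarithms without additive constants,
    so the claimed bounds are reached by adding these two nonnegative amounts.\<close>
  have slack: "0 \<le> (64 * \<sigma>2max + 32 * \<Sigma>2max) / \<mu>" "0 \<le> 16 * L\<^sup>2 * D\<^sup>2 / \<mu>" using constants by simp_all
  have expand: "16 * (2 * \<sigma>2max + \<Sigma>2max) / \<mu> = (32 * \<sigma>2max + 16 * \<Sigma>2max) / \<mu>"
    "(16 * L\<^sup>2 * D\<^sup>2 + 4 * G\<^sup>2) / \<mu> = 16 * L\<^sup>2 * D\<^sup>2 / \<mu> + 4 * G\<^sup>2 / \<mu>"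
    by (simp_all add: add_divide_distrib)
  have weaken: "(32 * \<sigma>2max + 16 * \<Sigma>2max) / \<mu> * ln ((2 * V + W) / (2 * \<sigma>2max + \<Sigma>2max) + 1)
      \<le> 64 / \<mu> * (\<sigma>2max + \<Sigma>2max) * ln (1 + (V + W) / (\<sigma>2max + \<Sigma>2max))"
    by (rule log_bound_weaken[OF constants(5-7) VW \<mu>])
  show ?thesis
    using regret slack weaken unfolding expand C_def regret_offset_def V_def[symmetric] W_def[symmetric]
    by linarith
qed

end
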